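(* Let $\gamma,\delta:\mathbb{N}\to\mathbb{C}$ be arithmetic functions supported on $n\le N_1$ and $n\le N_2$ respectively, and let $Q_0\ge1$. For a Dirichlet character $\chi$ let $Q(\chi)$ be the conductor of the primitive character inducing $\chi$. For $q\ge1$ and $(a,q)=1$ put \[ S(a,q)=\sum_{\substack{n_1\equiv an_2\ (\mathrm{mod}\ q)\\ (n_1n_2,q)=1}}\gamma(n_1)\delta(n_2),\qquad \mathcal M(a,q)=\frac{1}{\phi(q)}\sum_{n_1,n_2}\gamma(n_1)\delta(n_2)\sum_{\substack{\chi\ (\mathrm{mod}\ q)\\ Q(\chi)\le Q_0}}\chi(n_1)\overline{\chi(an_2)}, \] and $\mathcal E(a,q)=S(a,q)-\mathcal M(a,q)$. Then for every $Q\in\mathbb{N}$, \[ \sum_{q\le Q}\ \sum_{\substack{a\ (\mathrm{mod}\ q)\\ (a,q)=1}}|\mathcal E(a,q)|^2\ll\left(Q+\frac{N_1N_2}{Q_0}\right)(\log Q)\,\|\gamma\tau\|^2\,\|\delta\tau\|^2, \] with an absolute implied constant.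
   Context: For a finitely supported arithmetic function $c$, $\|c\tau\|^2=\sum_n|c(n)|^2\tau(n)^2$, where $\tau$ is the divisor function. $\phi$ is Euler's totient function. *)

theory Defs
  imports "HOL-Analysis.Analysis" "HOL-Number_Theory.Number_Theory"
begin

definition dirichlet_char :: "nat \<Rightarrow> (nat \<Rightarrow> complex) \<Rightarrow> bool" where
  "dirichlet_char q chi \<longleftrightarrow> q \<ge> 1 \<and>
     (\<forall>n. chi (n + q) = chi n) \<and>
     (\<forall>m n. chi (m * n) = chi m * chi n) \<and>
     chi 1 = 1 \<and>
     (\<forall>n. chi n = 0 \<longleftrightarrow> \<not> coprime n q)"

text \<open>Conductor: modulus of the primitive character inducing chi, i.e. the least
  divisor d of q such that chi is induced by a character modulo d.\<close>
definition conductor :: "nat \<Rightarrow> (nat \<Rightarrow> complex) \<Rightarrow> nat" where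
  "conductor q chi = (LEAST d. d dvd q \<and>
     (\<exists>psi. dirichlet_char d psi \<and> (\<forall>n. coprime n q \<longrightarrow> chi n = psi n)))"

definition tau :: "nat \<Rightarrow> nat" where
  "tau n = card {d. d dvd n}"

text \<open>For finitely supported c: the quantity \<parallel>c \<tau>\<parallel>^2.\<close>
definition tau_norm2 :: "(nat \<Rightarrow> complex) \<Rightarrow> real" where
  "tau_norm2 c = (\<Sum>n | c n \<noteq> 0. (cmod (c n))^2 * (real (tau n))^2)"

definition S_sum :: "(nat \<Rightarrow> complex) \<Rightarrow> (nat \<Rightarrow> complex) \<Rightarrow> nat \<Rightarrow> nat \<Rightarrow> nat \<Rightarrow> nat \<Rightarrow> complex" where
  "S_sum \<gamma> \<delta> N1 N2 a q = (\<Sum>n1\<in>{1..N1}. \<Sum>n2\<in>{1..N2}.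
     if [n1 = a * n2] (mod q) \<and> coprime (n1 * n2) q then \<gamma> n1 * \<delta> n2 else 0)"

definition M_sum :: "(nat \<Rightarrow> complex) \<Rightarrow> (nat \<Rightarrow> complex) \<Rightarrow> nat \<Rightarrow> nat \<Rightarrow> real \<Rightarrow> nat \<Rightarrow> nat \<Rightarrow> complex" where
  "M_sum \<gamma> \<delta> N1 N2 Q0 a q = (1 / of_nat (totient q)) *
     (\<Sum>n1\<in>{1..N1}. \<Sum>n2\<in>{1..N2}. \<gamma> n1 * \<delta> n2 *
       (\<Sum>chi \<in> {chi. dirichlet_char q chi \<and> real (conductor q chi) \<le> Q0}.
          chi n1 * cnj (chi (a * n2))))"

definition E_sum where
  "E_sum \<gamma> \<delta> N1 N2 Q0 a q = S_sum \<gamma> \<delta> N1 N2 a q - M_sum \<gamma> \<delta> N1 N2 Q0 a q"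

end

theory Submission
  imports Defs
begin

text \<open>By orthogonality of characters, the sum over \<open>a\<close> of \<open>\<bar>E(a, q)\<bar>\<^sup>2\<close> is \<open>1 / \<phi>(q)\<close> times the sum, over the
  characters modulo \<open>q\<close> of conductor exceeding \<open>Q0\<close>, of the squared modulus of a Dirichlet polynomial of
  length \<open>N1 * N2\<close> whose coefficients are the multiplicative convolution of \<open>\<gamma>\<close> and the conjugate
  of \<open>\<delta>\<close>. Writing \<open>q = r * s\<close> with \<open>r\<close> the conductor and using \<open>\<phi>(r * s) \<ge> \<phi>(r) * \<phi>(s)\<close>, the
  multiplicative large sieve and partial summation over \<open>r > Q0\<close> bound the contribution of each \<open>s\<close>
  by \<open>(Q + N1 * N2 / Q0) / \<phi>(s)\<close>; the sum over \<open>s\<close> costs the logarithm, and the divisor bound for the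
  convolution yields the two norms.

  The additive large sieve is proved by a discrete form of Gallagher's method: for a common multiple \<open>P\<close>
  of the denominators, the value of the exponential sum at \<open>a / r\<close> is a sum of values of a modified
  exponential sum at \<open>K\<close> consecutive multiples of \<open>1 / P\<close>; these blocks are disjoint for different
  fractions, so that Parseval's identity modulo \<open>P\<close> applies.\<close>

section \<open>The additive large sieve\<close>

text \<open>Expanding the square and interchanging the sums leaves only the diagonal. It serves
  additive characters summed over residues, Dirichlet characters summed over residues, and residues
  tested against all Dirichlet characters.\<close>

lemma parseval_orthogonal:
  fixes u :: "'i \<Rightarrow> 'j \<Rightarrow> complex" and K :: real
  assumes "finite I" 
    and orth: "\<And>m n. m \<in> I \<Longrightarrow> n \<in> I \<Longrightarrow>
      (\<Sum>j\<in>J. u m j * cnj (u n j)) = (if m = n then of_real K else 0)"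
  shows "(\<Sum>j\<in>J. (cmod (\<Sum>n\<in>I. x n * u n j))\<^sup>2) = K * (\<Sum>n\<in>I. (cmod (x n))\<^sup>2)"
proof -
  have "complex_of_real (\<Sum>j\<in>J. (cmod (\<Sum>n\<in>I. x n * u n j))\<^sup>2)
      = (\<Sum>j\<in>J. \<Sum>m\<in>I. \<Sum>n\<in>I. x m * cnj (x n) * (u m j * cnj (u n j)))"
    by (simp add: complex_norm_square sum_product mult_ac flip: of_real_power)
  also have "\<dots> = (\<Sum>m\<in>I. \<Sum>n\<in>I. \<Sum>j\<in>J. x m * cnj (x n) * (u m j * cnj (u n j)))"
    by (subst sum.swap, rule sum.cong[OF refl], rule sum.swap)
  also have "\<dots> = (\<Sum>m\<in>I. \<Sum>n\<in>I. if m = n then x m * cnj (x n) * of_real K else 0)"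
    by (intro sum.cong refl) (simp add: sum_distrib_left[symmetric] orth)
  also have "\<dots> = of_real (K * (\<Sum>n\<in>I. (cmod (x n))\<^sup>2))"
    using assms(1) by (simp add: complex_norm_square sum_distrib_left mult_ac flip: of_real_power)
  finally show ?thesis
    by (simp only: of_real_eq_iff)
qed

section \<open>Additive characters modulo q\<close>

definition ee :: "nat \<Rightarrow> nat \<Rightarrow> complex" where
  "ee q n = cis (2 * pi * real n / real q)"

lemma ee_0 [simp]: "ee q 0 = 1"
  by (simp add: ee_def)

lemma ee_add: "ee q (m + n) = ee q m * ee q n"
  by (simp add: ee_def cis_mult ring_distribs add_divide_distrib)

lemma ee_mult: "ee q (m * n) = ee q n ^ m"
  by (induction m) (simp_all add: ee_add)

lemma norm_ee [simp]: "cmod (ee q n) = 1"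
  by (simp add: ee_def)

lemma ee_mult_left:
  assumes "q > 0" "k > 0"
  shows "ee (q * k) (n * k) = ee q n"
  using assms by (simp add: ee_def mult.assoc)

lemma ee_eq_iff:
  assumes "q > 0"
  shows "ee q m = ee q n \<longleftrightarrow> [m = n] (mod q)"
  using complex_root_unity_eq[of q m n] assms
  by (simp add: ee_def cis_conv_exp cong_def mult_ac)

lemma ee_self [simp]:
  assumes "q > 0"
  shows "ee q q = 1"
  using ee_eq_iff[OF assms, of q 0] by (simp add: cong_def)

text \<open>The sum is geometric in a q-th root of unity \<open>w\<close>, and \<open>w = 1\<close>
  exactly when m and n are congruent.\<close>

lemma ee_orthogonal:
  assumes "q > 0"
  shows "(\<Sum>a<q. ee q (a * m) * cnj (ee q (a * n))) = (if [m = n] (mod q) then of_nat q else 0)"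
proof -
  define w where "w = ee q m * cnj (ee q n)"
  have inv: "ee q n * cnj (ee q n) = 1"
    by (simp flip: complex_norm_square)
  have "w ^ q = 1"
    unfolding w_def power_mult_distrib ee_mult[symmetric] complex_cnj_power[symmetric]
    using ee_mult[of q m q] ee_mult[of q n q] assms by (simp add: mult.commute[of q] ee_mult)
  moreover have "w = 1 \<longleftrightarrow> [m = n] (mod q)"
    unfolding ee_eq_iff[OF assms, symmetric] w_def using inv
    by (metis mult.left_neutral mult.right_neutral mult.assoc mult.commute)
  moreover have "(\<Sum>a<q. ee q (a * m) * cnj (ee q (a * n))) = (\<Sum>a<q. w ^ a)"
    by (simp add: w_def ee_mult power_mult_distrib)
  ultimately show ?thesis
    by (auto simp: sum_gp_strict)
qed

lemma parseval_ee:
  assumes "q > 0" and "finite I" "inj_on (\<lambda>n. n mod q) I"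
  shows "(\<Sum>a<q. (cmod (\<Sum>n\<in>I. x n * ee q (a * n)))\<^sup>2) = real q * (\<Sum>n\<in>I. (cmod (x n))\<^sup>2)"
  using assms
  by (intro parseval_orthogonal) (auto simp: ee_orthogonal cong_def inj_on_def)

section \<open>Reduced residues and the spacing of Farey fractions\<close>

text \<open>Representatives lie below q, unlike those in \<open>totatives\<close>, so that
  \<open>n mod q\<close> is always the representative of a unit n; for q = 1 the only unit is
  0.\<close>

definition units_mod :: "nat \<Rightarrow> nat set" where
  "units_mod q = {a. a < q \<and> coprime a q}"

lemma finite_units_mod [simp]: "finite (units_mod q)"
  by (simp add: units_mod_def)

lemma card_units_mod:
  assumes "q > 0"
  shows "card (units_mod q) = totient q"
proof (cases "q = 1")
  case True
  then have "units_mod q = {0}" by (auto simp: units_mod_def)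
  with True show ?thesis by simp
next
  case False
  then have "units_mod q = totatives q"
    using assms totatives_less[of _ q] False
    by (auto simp: units_mod_def in_totatives_iff intro!: Nat.gr0I)
  then show ?thesis by (simp add: totient_def)
qed

text \<open>Distinct reduced fractions with denominators up to R differ by at least 1 / R^2, hence
  by at least K when measured in units of 1 / P. Blocks of K consecutive multiples of 1 / P starting
  at these fractions therefore do not meet.\<close>

lemma farey_shifts_inj:
  assumes "\<And>r. r \<in> {1..R} \<Longrightarrow> r dvd P" and "K * R\<^sup>2 \<le> P"
  shows "inj_on (\<lambda>((r, a), k). a * (P div r) + k) ((SIGMA r:{1..R}. units_mod r) \<times> {..<K})"
proof -
  have main: "a * r' = a' * r \<and> k = k'"
    if hyps: "r \<in> {1..R}" "r' \<in> {1..R}" "k < K" "k' < K"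
      and eq: "a * (P div r) + k = a' * (P div r') + k'" for r r' a a' k k'
  proof -
    obtain u u' where u: "P = r * u" "P = r' * u'"
      using assms(1) hyps(1,2) by (meson dvd_def)
    have "u = P div r" "u' = P div r'"
      using u hyps(1,2) by (metis atLeastAtMost_iff nonzero_mult_div_cancel_left not_one_le_zero)+
    with eq have eq': "int a * int u + int k = int a' * int u' + int k'"
      by (metis of_nat_add of_nat_mult)
    \<comment> \<open>Multiplying by r * r' turns both quotients into P. In the resulting identity
      \<open>E\<close> the right side is smaller than P in absolute value, so the integer factor of
      P on the left vanishes.\<close>
    have "int k * (int r * int r') = int a' * int r * (int r' * int u') + int k' * (int r * int r')
        - int a * int r' * (int r * int u)"
      using arg_cong[OF eq', of "\<lambda>x. x * (int r * int r')"] by (simp add: algebra_simps)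
    also have "int r' * int u' = int P" using u(2) by simp
    also have "int r * int u = int P" using u(1) by simp
    finally have E: "(int a * int r' - int a' * int r) * int P = (int k' - int k) * (int r * int r')"
      by (simp add: algebra_simps)
    have "int r * int r' \<le> int R * int R"
      using hyps by (intro mult_mono) auto
    moreover have "\<bar>int k' - int k\<bar> < int K" "0 < int r * int r'"
      using hyps by auto
    ultimately have "\<bar>int k' - int k\<bar> * (int r * int r') < int K * (int R * int R)"
      by (intro mult_less_le_imp_less) auto
    also have "\<dots> \<le> int P"
      using assms(2) by (metis of_nat_le_iff of_nat_mult power2_eq_square)
    finally have "\<bar>int a * int r' - int a' * int r\<bar> * int P < 1 * int P"
      using E by (metis abs_mult abs_of_nonneg of_nat_0_le_iff of_nat_mult mult_1)
    then have "int a * int r' = int a' * int r"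
      by (subst (asm) mult_less_cancel_right) auto
    then have "a * r' = a' * r" "k = k'"
      using E hyps by (auto simp flip: of_nat_mult)
    then show ?thesis by simp
  qed
  have cop: "r = r' \<and> a = a'" if "a * r' = a' * r" "coprime a r" "coprime a' r'" "r > 0" for a a' r r' :: nat
  proof -
    have "r dvd r'"
      using that(1,2) by (metis coprime_commute coprime_dvd_mult_right_iff dvd_triv_right)
    moreover have "r' dvd r"
      using that(1,3) by (metis coprime_commute coprime_dvd_mult_right_iff dvd_triv_right)
    ultimately have "r = r'" by (rule dvd_antisym)
    then show ?thesis using that by simp
  qed
  show ?thesis
  proof (rule inj_onI)
    fix x y
    assume xy: "x \<in> (SIGMA r:{1..R}. units_mod r) \<times> {..<K}" "y \<in> (SIGMA r:{1..R}. units_mod r) \<times> {..<K}"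
      "(\<lambda>((r, a), k). a * (P div r) + k) x = (\<lambda>((r, a), k). a * (P div r) + k) y"
    obtain r a k r' a' k' where "x = ((r, a), k)" "y = ((r', a'), k')"
      by (metis surj_pair)
    with xy show "x = y"
      using main[of r r' k k' a a'] cop[of a r' a' r] by (auto simp: units_mod_def)
  qed
qed

lemma additive_large_sieve:
  fixes c :: "nat \<Rightarrow> complex"
  shows "(\<Sum>r=1..R. \<Sum>a\<in>units_mod r. (cmod (\<Sum>n=1..N. c n * ee r (a * n)))\<^sup>2)
    \<le> 4 * (real R ^ 2 + 6 * real N) * (\<Sum>n=1..N. (cmod (c n))\<^sup>2)"
proof (cases "R = 0 \<or> N = 0")
  case False
  \<comment> \<open>The factorial makes every r up to R divide P. In T, the summand R^2 keeps the
    blocks disjoint and the summand 6 * N keeps all angles 2 * pi * k * n / P with k < K and n \<le>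
    N at most pi / 3.\<close>
  define K :: nat where "K = fact R"
  define T where "T = R\<^sup>2 + 6 * N"
  define P where "P = K * T"
  have pos: "K > 0" "T > 0" "P > 0"
    using False by (auto simp: K_def T_def P_def)
  have dvd: "r dvd P" if "r \<in> {1..R}" for r
    unfolding P_def K_def using that by (intro dvd_mult2 dvd_fact) auto
  have KR: "K * R\<^sup>2 \<le> P" by (simp add: P_def T_def)
  \<comment> \<open>Summing over a block multiplies the n-th term by \<open>D n\<close>. Every
    summand has real part at least 1/2, so \<open>D n\<close> is at least K / 2 in modulus and can
    be divided out of the coefficients.\<close>
  define D where "D n = (\<Sum>k<K. ee P (k * n))" for n
  have D: "real K / 2 \<le> cmod (D n)" if "n \<in> {1..N}" for n
  proof -
    have "1/2 \<le> Re (ee P (k * n))" if "k < K" for k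
    proof -
      have "k * n * 6 \<le> P"
        using mult_mono[of k K n N] \<open>k < K\<close> \<open>n \<in> {1..N}\<close> by (auto simp: P_def T_def algebra_simps)
      then have "real (k * n) * 6 \<le> real P" by (metis of_nat_le_iff of_nat_mult of_nat_numeral)
      then have "2 * pi * real (k * n) / real P \<le> pi / 3"
        using pos by (simp add: field_simps)
      then have "cos (pi / 3) \<le> cos (2 * pi * real (k * n) / real P)"
        by (intro cos_monotone_0_pi_le) auto
      then show ?thesis by (simp add: ee_def cos_60)
    qed
    then have "(\<Sum>k<K. 1/2) \<le> (\<Sum>k<K. Re (ee P (k * n)))"
      by (intro sum_mono) auto
    also have "\<dots> = Re (D n)" by (simp add: D_def)
    also have "\<dots> \<le> cmod (D n)" by (rule complex_Re_le_cmod)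
    finally show ?thesis by simp
  qed
  have D0: "D n \<noteq> 0" if "n \<in> {1..N}" for n
    using D[OF that] pos by auto
  define g where "g A = (\<Sum>n=1..N. c n / D n * ee P (A * n))" for A
  \<comment> \<open>The block sum of \<open>g\<close> restores the original exponential sum;
    Cauchy-Schwarz over its K terms costs the factor K.\<close>
  have point: "(cmod (\<Sum>n=1..N. c n * ee r (a * n)))\<^sup>2 \<le> real K * (\<Sum>k<K. (cmod (g (a * (P div r) + k)))\<^sup>2)"
    if "r \<in> {1..R}" for r a
  proof -
    have "ee r (a * n) = ee P (a * (P div r) * n)" for n
      using ee_mult_left[of r "P div r" "a * n"] dvd[OF that] that pos
      by (auto simp: dvd_div_eq_0_iff mult_ac intro: Nat.gr0I)
    then have "(\<Sum>n=1..N. c n * ee r (a * n)) = (\<Sum>n=1..N. \<Sum>k<K. c n / D n * ee P ((a * (P div r) + k) * n))"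
      using D0 by (intro sum.cong) (auto simp: ring_distribs ee_add sum_distrib_left[symmetric] D_def[symmetric] sum_divide_distrib[symmetric])
    also have "\<dots> = (\<Sum>k<K. g (a * (P div r) + k))"
      unfolding g_def by (rule sum.swap)
    finally have "cmod (\<Sum>n=1..N. c n * ee r (a * n)) \<le> (\<Sum>k<K. cmod (g (a * (P div r) + k)))"
      by (simp add: norm_sum)
    then have "(cmod (\<Sum>n=1..N. c n * ee r (a * n)))\<^sup>2 \<le> (\<Sum>k<K. cmod (g (a * (P div r) + k)))\<^sup>2"
      by (intro power_mono) auto
    also have "\<dots> \<le> real K * (\<Sum>k<K. (cmod (g (a * (P div r) + k)))\<^sup>2)"
      using sum_squared_le_sum_of_squares[of "\<lambda>k. cmod (g (a * (P div r) + k))" "{..<K}"] by (simp add: mult.commute)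
    finally show ?thesis .
  qed
  let ?S = "SIGMA r:{1..R}. units_mod r"
  let ?h = "\<lambda>((r, a), k). a * (P div r) + k"
  have "(\<Sum>r=1..R. \<Sum>a\<in>units_mod r. (cmod (\<Sum>n=1..N. c n * ee r (a * n)))\<^sup>2)
      \<le> (\<Sum>r=1..R. \<Sum>a\<in>units_mod r. real K * (\<Sum>k<K. (cmod (g (a * (P div r) + k)))\<^sup>2))"
    by (intro sum_mono point)
  also have "\<dots> = (\<Sum>(r, a)\<in>?S. real K * (\<Sum>k<K. (cmod (g (a * (P div r) + k)))\<^sup>2))"
    by (rule sum.Sigma) auto
  also have "\<dots> = real K * (\<Sum>p\<in>?S. \<Sum>k<K. (cmod (g (?h (p, k))))\<^sup>2)"
    by (simp add: sum_distrib_left split_def)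
  also have "(\<Sum>p\<in>?S. \<Sum>k<K. (cmod (g (?h (p, k))))\<^sup>2) = (\<Sum>x\<in>?S \<times> {..<K}. (cmod (g (?h x)))\<^sup>2)"
    by (subst sum.cartesian_product) (rule sum.cong, auto)
  also have "\<dots> = (\<Sum>A\<in>?h ` (?S \<times> {..<K}). (cmod (g A))\<^sup>2)"
    using sum.reindex[OF farey_shifts_inj[OF dvd KR], of "\<lambda>A. (cmod (g A))\<^sup>2"] by (simp only: o_def)
  \<comment> \<open>By positivity the union of the blocks is enlarged to a full residue system. No
    block passes P, because a + 1 \<le> r and K \<le> P div r.\<close>
  also have "\<dots> \<le> (\<Sum>A<P. (cmod (g A))\<^sup>2)"
  proof (rule sum_mono2)
    show "(\<lambda>((r, a), k). a * (P div r) + k) ` (?S \<times> {..<K}) \<subseteq> {..<P}"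
    proof clarsimp
      fix r a k assume *: "k < K" "Suc 0 \<le> r" "r \<le> R" "a \<in> units_mod r"
      have "K * r \<le> P"
        using KR * by (metis One_nat_def le_square mult_le_mono order.refl order.trans power2_eq_square)
      then have "K \<le> P div r"
        using * by (simp add: less_eq_div_iff_mult_less_eq)
      moreover have "Suc a * (P div r) \<le> r * (P div r)"
        using * by (intro mult_le_mono) (auto simp: units_mod_def)
      moreover have "r * (P div r) = P"
        using dvd * by auto
      ultimately show "a * (P div r) + k < P"
        using \<open>k < K\<close> by (simp add: algebra_simps)
    qed
  qed auto
  also have "\<dots> = real P * (\<Sum>n=1..N. (cmod (c n / D n))\<^sup>2)"
  proof -
    \<comment> \<open>This makes the frequencies 1, ..., N distinct modulo P, as Parseval's identity
      requires.\<close>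
    have "N < P"
      using False mult_mono[of 1 K "6 * N" T] pos by (simp add: P_def T_def)
    then show ?thesis
      unfolding g_def using pos by (intro parseval_ee) (auto simp: inj_on_def)
  qed
  also have "\<dots> \<le> real P * (\<Sum>n=1..N. 4 / real K ^ 2 * (cmod (c n))\<^sup>2)"
  proof (intro mult_left_mono sum_mono)
    fix n assume n: "n \<in> {1..N}"
    have "(cmod (c n))\<^sup>2 * (real K / 2)\<^sup>2 \<le> (cmod (c n))\<^sup>2 * (cmod (D n))\<^sup>2"
      using D[OF n] by (intro mult_left_mono power_mono) auto
    then show "(cmod (c n / D n))\<^sup>2 \<le> 4 / real K ^ 2 * (cmod (c n))\<^sup>2"
      using pos D0[OF n] by (simp add: norm_divide field_simps)
  qed auto
  \<comment> \<open>K from Cauchy-Schwarz, P = K * T from Parseval and 4 / K^2 from the lower bound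
    for \<open>D\<close> multiply to 4 * T.\<close>
  also have "real K * (real P * (\<Sum>n=1..N. 4 / real K ^ 2 * (cmod (c n))\<^sup>2))
      = 4 * (real R ^ 2 + 6 * real N) * (\<Sum>n=1..N. (cmod (c n))\<^sup>2)"
    unfolding sum_distrib_left[symmetric] using pos by (simp add: P_def T_def field_simps power2_eq_square)
  finally show ?thesis by (simp add: mult_left_mono)
qed (auto intro!: mult_nonneg_nonneg sum_nonneg)

section \<open>Dirichlet characters\<close>

definition dirichlet_chars :: "nat \<Rightarrow> (nat \<Rightarrow> complex) set" where
  "dirichlet_chars q = {chi. dirichlet_char q chi}"

context
  fixes q :: nat and chi :: "nat \<Rightarrow> complex"
  assumes chi: "dirichlet_char q chi"
begin

lemma dchar_pos: "q > 0"
  using chi by (simp add: dirichlet_char_def)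

lemma dchar_mult: "chi (m * n) = chi m * chi n"
  using chi by (simp add: dirichlet_char_def)

lemma dchar_1: "chi (Suc 0) = 1"
  using chi by (simp add: dirichlet_char_def)

lemma dchar_eq_0_iff: "chi n = 0 \<longleftrightarrow> \<not> coprime n q"
  using chi by (simp add: dirichlet_char_def)

lemma dchar_power: "chi (n ^ k) = chi n ^ k"
  by (induction k) (simp_all add: dchar_mult dchar_1)

lemma dchar_add_mult: "chi (n + k * q) = chi n"
  using chi by (induction k) (simp_all add: dirichlet_char_def add.assoc[symmetric] add.commute[of q])

lemma dchar_mod: "chi (n mod q) = chi n"
  using dchar_add_mult[of "n mod q" "n div q"] by simp

lemma dchar_cong:
  assumes "[m = n] (mod q)"
  shows "chi m = chi n"
  using assms dchar_mod[of m] dchar_mod[of n] by (simp add: cong_def)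

lemma dchar_power_totient:
  assumes "coprime n q"
  shows "chi n ^ totient q = 1"
  using dchar_cong[OF euler_theorem[OF assms]] by (simp add: dchar_power dchar_1)

lemma norm_dchar:
  assumes "coprime n q"
  shows "cmod (chi n) = 1"
proof -
  have "cmod (chi n) ^ totient q = 1"
    using dchar_power_totient[OF assms] by (metis norm_one norm_power)
  then show ?thesis
    using dchar_pos power_eq_imp_eq_base[of "cmod (chi n)" "totient q" 1] by simp
qed

lemma dchar_mult_cnj: "chi n * cnj (chi n) = (if coprime n q then 1 else 0)"
  using norm_dchar[of n] dchar_eq_0_iff[of n] by (simp flip: complex_norm_square)

end

lemma dchar_eqI:
  assumes "dirichlet_char q chi" "dirichlet_char q psi" "\<And>n. n \<in> units_mod q \<Longrightarrow> chi n = psi n"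
  shows "chi = psi"
proof
  fix n
  show "chi n = psi n"
  proof (cases "coprime n q")
    case True
    then have "n mod q \<in> units_mod q"
      using dchar_pos[OF assms(1)] by (simp add: units_mod_def)
    then show ?thesis
      using assms by (metis dchar_mod)
  qed (use dchar_eq_0_iff assms in metis)
qed

text \<open>A character is determined by its values on the finitely many units, and these are roots
  of unity of order dividing \<open>totient q\<close>.\<close>

lemma finite_dirichlet_chars [simp]: "finite (dirichlet_chars q)"
proof (cases "q = 0")
  case False
  let ?Z = "{z :: complex. z ^ totient q = 1}"
  have "finite ?Z"
    using False by (intro finite_roots_unity) (simp add: Suc_le_eq)
  then have "finite (units_mod q \<rightarrow>\<^sub>E ?Z)"
    by (intro finite_PiE) auto
  moreover have "(\<lambda>chi. restrict chi (units_mod q)) ` dirichlet_chars q \<subseteq> (units_mod q \<rightarrow>\<^sub>E ?Z)"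
    by (auto simp: dirichlet_chars_def units_mod_def dchar_power_totient PiE_def extensional_def)
  moreover have "inj_on (\<lambda>chi. restrict chi (units_mod q)) (dirichlet_chars q)"
    by (intro inj_onI dchar_eqI[of q]) (auto simp: dirichlet_chars_def restrict_def fun_eq_iff, metis)
  ultimately show ?thesis
    by (meson finite_imageD finite_subset)
qed (simp add: dirichlet_chars_def dirichlet_char_def)

lemma bij_betw_units_mod_mult:
  assumes "coprime b q" "q > 0"
  shows "bij_betw (\<lambda>a. a * b mod q) (units_mod q) (units_mod q)"
  unfolding bij_betw_def
proof
  show "inj_on (\<lambda>a. a * b mod q) (units_mod q)"
  proof (rule inj_onI)
    fix x y assume *: "x \<in> units_mod q" "y \<in> units_mod q" "x * b mod q = y * b mod q"
    then have "[x = y] (mod q)"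
      using assms by (metis cong_def cong_mult_rcancel_nat)
    with * show "x = y"
      by (simp add: units_mod_def cong_def)
  qed
  then show "(\<lambda>a. a * b mod q) ` units_mod q = units_mod q"
    using assms by (intro endo_inj_surj) (auto simp: units_mod_def)
qed

lemma sum_units_mod_mult:
  fixes f :: "nat \<Rightarrow> 'a :: comm_monoid_add"
  assumes "coprime b q" "q > 0" "\<And>n. f (n mod q) = f n"
  shows "(\<Sum>a\<in>units_mod q. f (a * b)) = (\<Sum>a\<in>units_mod q. f a)"
  using sum.reindex_bij_betw[OF bij_betw_units_mod_mult[OF assms(1,2)], of f] by (simp add: assms(3))

text \<open>If the characters differ at a unit b, the substitution of a * b for a multiplies the sum
  by chi(b) times the conjugate of psi(b), which is not 1.\<close>

lemma dchar_orthogonal: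
  assumes "dirichlet_char q chi" "dirichlet_char q psi"
  shows "(\<Sum>a\<in>units_mod q. chi a * cnj (psi a)) = (if chi = psi then of_nat (totient q) else 0)"
proof (cases "chi = psi")
  case True
  have "(\<Sum>a\<in>units_mod q. chi a * cnj (psi a)) = (\<Sum>a\<in>units_mod q. 1)"
    using assms by (intro sum.cong) (auto simp: True dchar_mult_cnj units_mod_def)
  then show ?thesis
    using True card_units_mod dchar_pos[OF assms(1)] by simp
next
  case False
  then obtain b where b: "b \<in> units_mod q" "chi b \<noteq> psi b"
    using dchar_eqI assms by blast
  then have cop: "coprime b q" by (simp add: units_mod_def)
  let ?S = "\<Sum>a\<in>units_mod q. chi a * cnj (psi a)"
  have "?S = (\<Sum>a\<in>units_mod q. chi (a * b) * cnj (psi (a * b)))"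
    using assms cop dchar_pos[OF assms(1)]
    by (intro sum_units_mod_mult[symmetric]) (auto simp: dchar_mod)
  also have "\<dots> = chi b * cnj (psi b) * ?S"
    using assms by (simp add: dchar_mult sum_distrib_left mult_ac)
  finally have "?S = 0 \<or> chi b * cnj (psi b) = 1"
    by (simp add: mult_cancel_right1)
  moreover have "chi b * cnj (psi b) \<noteq> 1"
  proof
    assume *: "chi b * cnj (psi b) = 1"
    have "chi b * (psi b * cnj (psi b)) = psi b * (chi b * cnj (psi b))" by (simp only: mult_ac)
    with * b(2) cop assms show False by (simp add: dchar_mult_cnj)
  qed
  ultimately show ?thesis using False by simp
qed

text \<open>The functions on the group of units modulo \<open>q\<close>, extended by 0. Characters are found in this
  space as simultaneous eigenvectors of the commuting translations \<open>f \<mapsto> (\<lambda>g. f (g * x))\<close>, each of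
  which is a \<open>totient q\<close>-th root of the identity.\<close>

definition unit_fun :: "nat \<Rightarrow> (nat \<Rightarrow> complex) \<Rightarrow> bool" where
  "unit_fun q f \<longleftrightarrow> (\<forall>m n. [m = n] (mod q) \<longrightarrow> f m = f n) \<and> (\<forall>n. \<not> coprime n q \<longrightarrow> f n = 0)"

text \<open>Fourier averaging over the powers of \<open>x\<close>: for a unit \<open>x\<close> this
  is \<open>totient q\<close> times the projection onto the eigenspace of translation by
  \<open>x\<close> with eigenvalue \<open>ee (totient q) j\<close>.\<close>

definition eigen_proj :: "nat \<Rightarrow> nat \<Rightarrow> nat \<Rightarrow> (nat \<Rightarrow> complex) \<Rightarrow> nat \<Rightarrow> complex" where
  "eigen_proj q x j f g = (\<Sum>k<totient q. cnj (ee (totient q) (k * j)) * f (g * x ^ k))"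

lemma unit_fun_eigen_proj:
  assumes "unit_fun q f"
  shows "unit_fun q (eigen_proj q x j f)"
  using assms unfolding unit_fun_def eigen_proj_def
  by (auto intro!: sum.cong sum.neutral intro: cong_mult) (metis cong_mult cong_refl)

text \<open>Translation by \<open>x\<close> moves the k-th term to the (k+1)-st up to the
  eigenvalue, and the sum closes up cyclically by Euler's theorem.\<close>

lemma eigen_proj_eigen:
  assumes "unit_fun q f" "coprime x q" "q > 0"
  shows "eigen_proj q x j f (g * x) = ee (totient q) j * eigen_proj q x j f g"
proof -
  define h where "h k = cnj (ee (totient q) (k * j)) * f (g * x ^ k)" for k
  have t: "totient q > 0" using assms by simp
  have "[g * x ^ totient q = g * 1] (mod q)"
    using euler_theorem[OF assms(2)] by (intro cong_mult) auto
  then have "f (g * x ^ totient q) = f g"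
    using assms(1) by (metis unit_fun_def mult_1_right)
  then have "h (totient q) = h 0"
    using ee_mult[of "totient q" j "totient q"] t by (simp add: h_def mult.commute[of "totient q"] ee_mult)
  moreover have "(\<Sum>k<totient q. h (Suc k)) = (\<Sum>k<totient q. h k) + h (totient q) - h 0"
    using sum.lessThan_Suc_shift[of h "totient q"] by simp
  ultimately have "(\<Sum>k<totient q. h (Suc k)) = eigen_proj q x j f g"
    by (simp add: h_def eigen_proj_def)
  moreover have "ee (totient q) j * cnj (ee (totient q) j) = 1"
    by (simp flip: complex_norm_square)
  then have "ee (totient q) j * h (Suc k) = cnj (ee (totient q) (k * j)) * f (g * x * x ^ k)" for k
    by (simp add: h_def ee_add mult_ac)
  then have "ee (totient q) j * (\<Sum>k<totient q. h (Suc k)) = eigen_proj q x j f (g * x)"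
    by (simp add: eigen_proj_def sum_distrib_left)
  ultimately show ?thesis by simp
qed

lemma eigen_proj_preserves:
  assumes "\<And>g. f (g * y) = w * f g"
  shows "eigen_proj q x j f (g * y) = w * eigen_proj q x j f g"
proof -
  have "f (g * y * x ^ k) = w * f (g * x ^ k)" for k
    using assms[of "g * x ^ k"] by (simp add: mult_ac)
  then show ?thesis
    by (simp add: eigen_proj_def sum_distrib_left mult_ac)
qed

text \<open>Orthogonality in j leaves only k = 0. Hence where \<open>f\<close> does not vanish, some
  eigencomponent does not vanish either.\<close>

lemma sum_eigen_proj:
  assumes "q > 0"
  shows "(\<Sum>j<totient q. eigen_proj q x j f g) = of_nat (totient q) * f g"
proof -
  have t: "totient q > 0" using assms by simp
  have "(\<Sum>j<totient q. eigen_proj q x j f g)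
      = (\<Sum>k<totient q. f (g * x ^ k) * (\<Sum>j<totient q. ee (totient q) (j * 0) * cnj (ee (totient q) (j * k))))"
    unfolding eigen_proj_def
    by (subst sum.swap) (simp add: sum_distrib_left mult_ac)
  also have "\<dots> = (\<Sum>k<totient q. if k = 0 then of_nat (totient q) * f g else 0)"
    unfolding ee_orthogonal[OF t] by (intro sum.cong) (auto simp: cong_def)
  finally show ?thesis using t by simp
qed

text \<open>Induction over A: some eigencomponent for the new unit is nonzero at the same point, and
  since translations commute, passing to it preserves all earlier eigenvalues. The pair y, w carries
  a prescribed eigenvalue through the induction.\<close>

lemma simultaneous_eigenfunction:
  assumes "q > 0" "finite A" "\<And>x. x \<in> A \<Longrightarrow> coprime x q"
    and "unit_fun q f" "f g0 \<noteq> 0" "\<And>g. f (g * y) = w * f g"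
  shows "\<exists>f' g0'. unit_fun q f' \<and> f' g0' \<noteq> 0 \<and> (\<forall>g. f' (g * y) = w * f' g) \<and>
    (\<forall>x\<in>A. \<exists>v. \<forall>g. f' (g * x) = v * f' g)"
  using assms(2,3)
proof (induction A)
  case empty
  then show ?case using assms(4-6) by blast
next
  case (insert x A)
  then obtain f' g0' where f': "unit_fun q f'" "f' g0' \<noteq> 0" "\<And>g. f' (g * y) = w * f' g"
    "\<forall>x\<in>A. \<exists>v. \<forall>g. f' (g * x) = v * f' g" by auto
  have "(\<Sum>j<totient q. eigen_proj q x j f' g0') \<noteq> 0"
    using sum_eigen_proj[OF assms(1), of x f' g0'] f'(2) assms(1) by simp
  then obtain j where j: "eigen_proj q x j f' g0' \<noteq> 0"
    by (meson sum.neutral)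
  have "unit_fun q (eigen_proj q x j f')"
    using f'(1) by (rule unit_fun_eigen_proj)
  moreover have "\<forall>g. eigen_proj q x j f' (g * y) = w * eigen_proj q x j f' g"
    using f'(3) by (simp add: eigen_proj_preserves)
  moreover have "\<forall>g. eigen_proj q x j f' (g * x) = ee (totient q) j * eigen_proj q x j f' g"
    using f'(1) insert.prems assms(1) by (simp add: eigen_proj_eigen)
  moreover have "\<exists>v. \<forall>g. eigen_proj q x j f' (g * z) = v * eigen_proj q x j f' g" if "z \<in> A" for z
    using f'(4) that eigen_proj_preserves by metis
  ultimately show ?case
    using j by (intro exI[of _ "eigen_proj q x j f'"] exI[of _ g0'] conjI) auto
qed

text \<open>The indicator of the class of 1 is not invariant under translation by m, so it has a
  nonzero component with eigenvalue w different from 1. Refined to a simultaneous eigenfunction for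
  all units and normalised at 1, this becomes a character with value w at m.\<close>

lemma separating_dchar:
  assumes "q > 0" "coprime m q" "\<not> [m = 1] (mod q)"
  obtains chi where "dirichlet_char q chi" "chi m \<noteq> 1"
proof -
  define d :: "nat \<Rightarrow> complex" where "d g = (if [g = 1] (mod q) then 1 else 0)" for g
  have t: "totient q > 0" using assms by simp
  have d: "unit_fun q d"
  proof -
    have "coprime n q" if "[n = 1] (mod q)" for n
      using cong_imp_coprime[OF cong_sym[OF that]] by simp
    then show ?thesis
      unfolding unit_fun_def d_def by (metis cong_sym cong_trans)
  qed
  have "\<exists>j g. j < totient q \<and> j \<noteq> 0 \<and> eigen_proj q m j d g \<noteq> 0"
  proof (rule ccontr)
    assume *: "\<not> ?thesis"
    \<comment> \<open>If only j = 0 contributed, \<open>d\<close> would be a multiple of a function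
      with eigenvalue 1, hence invariant under m.\<close>
    have "eigen_proj q m 0 d g = of_nat (totient q) * d g" for g
    proof -
      have "(\<Sum>j<totient q. eigen_proj q m j d g) = (\<Sum>j<totient q. if j = 0 then eigen_proj q m 0 d g else 0)"
        using * by (intro sum.cong) auto
      then show ?thesis
        using sum_eigen_proj[OF assms(1), of m d g] t by simp
    qed
    then have "of_nat (totient q) * d (1 * m) = of_nat (totient q) * d 1"
      using eigen_proj_eigen[OF d assms(2,1), of 0 1] by simp
    then have "d m = d 1" using t by simp
    then show False using assms by (simp add: d_def)
  qed
  then obtain j g where j: "j < totient q" "j \<noteq> 0" "eigen_proj q m j d g \<noteq> 0" by blast
  define w where "w = ee (totient q) j"
  have w: "w \<noteq> 1"
    using ee_eq_iff[OF t, of j 0] j by (simp add: w_def cong_def)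
  have "\<And>g. eigen_proj q m j d (g * m) = w * eigen_proj q m j d g"
    unfolding w_def by (intro eigen_proj_eigen d assms)
  note * = simultaneous_eigenfunction[OF assms(1) finite_units_mod[of q] _ unit_fun_eigen_proj[OF d] j(3) this]
  have "\<exists>f g0. unit_fun q f \<and> f g0 \<noteq> 0 \<and> (\<forall>g. f (g * m) = w * f g) \<and>
    (\<forall>x\<in>units_mod q. \<exists>v. \<forall>g. f (g * x) = v * f g)"
    by (rule *) (simp add: units_mod_def)
  then obtain f g0 where f: "unit_fun q f" "f g0 \<noteq> 0" "\<forall>g. f (g * m) = w * f g"
    "\<forall>x\<in>units_mod q. \<exists>v. \<forall>g. f (g * x) = v * f g"
    by (elim exE conjE)
  have per: "f a = f b" if "[a = b] (mod q)" for a b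
    using f(1) that unfolding unit_fun_def by blast
  have eig: "\<exists>v. \<forall>g. f (g * x) = v * f g" if "coprime x q" for x
  proof -
    have "x mod q \<in> units_mod q" using that assms by (simp add: units_mod_def)
    moreover have "f (g * x) = f (g * (x mod q))" for g
      by (rule per) (simp add: cong_def mod_mult_right_eq)
    ultimately show ?thesis using bspec[OF f(4), of "x mod q"] by simp
  qed
  have cop: "coprime n q" if "f n \<noteq> 0" for n
    using f(1) that unfolding unit_fun_def by blast
  have f1: "f 1 \<noteq> 0"
    using eig[OF cop[OF f(2)]] f(2) by (metis mult_1 mult_zero_right)
  have fmult: "f (a * n) * f 1 = f a * f n" for a n
  proof (cases "coprime n q")
    case True
    then obtain v where v: "\<And>g. f (g * n) = v * f g" using eig by blast
    show ?thesis using v[of a] v[of 1] by simp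
  next
    case False
    then have "\<not> coprime (a * n) q" by simp
    with False have "f n = 0" "f (a * n) = 0" using cop by blast+
    then show ?thesis by simp
  qed
  \<comment> \<open>A zero at a unit n would pass to all multiples of n, among them a power of n
    congruent to 1.\<close>
  have fn: "f n \<noteq> 0" if "coprime n q" for n
  proof
    assume "f n = 0"
    have "f (n ^ (totient q - 1) * n) * f 1 = 0"
      using fmult[of "n ^ (totient q - 1)" n] \<open>f n = 0\<close> by simp
    moreover have "n ^ (totient q - 1) * n = n ^ totient q"
      using t by (metis Suc_diff_1 power_Suc2)
    moreover have "f (n ^ totient q) = f 1"
      using euler_theorem[OF that] by (rule per)
    ultimately show False using f1 by simp
  qed
  define chi where "chi n = f n / f 1" for n
  have "dirichlet_char q chi"
    unfolding dirichlet_char_def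
  proof (intro conjI allI)
    fix n show "chi (n + q) = chi n"
      using per[of "n + q" n] by (simp add: chi_def cong_def)
  next
    fix a n show "chi (a * n) = chi a * chi n"
      using fmult[of a n] f1 by (simp add: chi_def field_simps)
  next
    fix n show "chi n = 0 \<longleftrightarrow> \<not> coprime n q"
      using fn cop f1 by (auto simp: chi_def)
  qed (use assms f1 in \<open>auto simp: chi_def\<close>)
  moreover have "chi m = w"
    using spec[OF f(3), of 1] f1 by (simp add: chi_def)
  ultimately show ?thesis using that w by blast
qed

lemma dirichlet_char_mult_prod:
  assumes "dirichlet_char q chi" "dirichlet_char q psi"
  shows "dirichlet_char q (\<lambda>n. chi n * psi n)"
  using assms by (auto simp: dirichlet_char_def)

text \<open>Multiplication by a character with value other than 1 at m permutes the characters and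
  multiplies the sum by that value.\<close>

lemma sum_dchars_eq_0:
  assumes "q > 0" "coprime m q" "\<not> [m = 1] (mod q)"
  shows "(\<Sum>chi\<in>dirichlet_chars q. chi m) = 0"
proof -
  obtain psi where psi: "dirichlet_char q psi" "psi m \<noteq> 1"
    using separating_dchar assms by blast
  let ?F = "\<lambda>chi n. psi n * chi n :: complex"
  have inj: "inj_on ?F (dirichlet_chars q)"
  proof (rule inj_onI)
    fix chi chi' assume *: "chi \<in> dirichlet_chars q" "chi' \<in> dirichlet_chars q" "?F chi = ?F chi'"
    show "chi = chi'"
    proof (rule dchar_eqI[of q])
      fix n assume "n \<in> units_mod q"
      then have "psi n \<noteq> 0" using psi(1) by (simp add: dchar_eq_0_iff units_mod_def)
      then show "chi n = chi' n" using fun_cong[OF *(3), of n] by simp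
    qed (use * in \<open>auto simp: dirichlet_chars_def\<close>)
  qed
  have "?F ` dirichlet_chars q = dirichlet_chars q"
    using inj psi by (intro endo_inj_surj finite_dirichlet_chars) (auto simp: dirichlet_chars_def dirichlet_char_mult_prod)
  then have "(\<Sum>chi\<in>dirichlet_chars q. chi m) = (\<Sum>chi\<in>dirichlet_chars q. ?F chi m)"
    using sum.reindex[OF inj, of "\<lambda>chi. chi m"] by (simp add: o_def)
  also have "\<dots> = psi m * (\<Sum>chi\<in>dirichlet_chars q. chi m)"
    by (simp add: sum_distrib_left)
  finally show ?thesis using psi(2) by (simp add: mult_cancel_right1)
qed

lemma principal_dchar:
  assumes "q > 0"
  shows "dirichlet_char q (\<lambda>n. if coprime n q then 1 else 0)"
  unfolding dirichlet_char_def
proof (intro conjI allI)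
  fix n show "(if coprime (n + q) q then 1 else 0 :: complex) = (if coprime n q then 1 else 0)"
    by (simp only: coprime_iff_gcd_eq_1 gcd_add1)
qed (use assms in auto)

text \<open>The double sum of chi(a) is evaluated twice: summing over chi first leaves only the
  class of 1, summing over a first leaves only the principal character.\<close>

lemma card_dirichlet_chars:
  assumes "q > 0"
  shows "card (dirichlet_chars q) = totient q"
proof -
  let ?p = "\<lambda>n. if coprime n q then 1 else 0 :: complex"
  have "complex_of_nat (card (dirichlet_chars q)) = (\<Sum>a\<in>units_mod q. \<Sum>chi\<in>dirichlet_chars q. chi a)"
  proof -
    \<comment> \<open>Written as \<open>1 mod q\<close> because the representative of 1 is 0 when q
      = 1.\<close>
    have one: "1 mod q \<in> units_mod q" using assms by (simp add: units_mod_def)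
    have "(\<Sum>chi\<in>dirichlet_chars q. chi a) = (if a = 1 mod q then of_nat (card (dirichlet_chars q)) else 0)"
      if "a \<in> units_mod q" for a
    proof (cases "[a = 1] (mod q)")
      case True
      then have "a = 1 mod q" using that by (simp add: cong_def units_mod_def)
      moreover have "(\<Sum>chi\<in>dirichlet_chars q. chi a) = (\<Sum>chi\<in>dirichlet_chars q. 1)"
        using True dchar_cong dchar_1 by (intro sum.cong) (auto simp: dirichlet_chars_def, metis)
      ultimately show ?thesis by simp
    next
      case False
      then have "a \<noteq> 1 mod q" by (auto simp: cong_def)
      with False show ?thesis using that assms by (simp add: sum_dchars_eq_0 units_mod_def)
    qed
    then show ?thesis using one by simp
  qed
  also have "\<dots> = (\<Sum>chi\<in>dirichlet_chars q. \<Sum>a\<in>units_mod q. chi a * cnj (?p a))"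
    by (subst sum.swap) (auto simp: units_mod_def intro!: sum.cong)
  also have "\<dots> = (\<Sum>chi\<in>dirichlet_chars q. if chi = ?p then of_nat (totient q) else 0)"
    using principal_dchar[OF assms]
    by (intro sum.cong refl dchar_orthogonal) (auto simp: dirichlet_chars_def)
  also have "\<dots> = of_nat (totient q)"
    using principal_dchar[OF assms] by (subst sum.delta[OF finite_dirichlet_chars]) (auto simp: dirichlet_chars_def)
  finally show ?thesis by simp
qed

text \<open>With n' an inverse of n modulo q, taken as a power of n, each term is chi(m * n'). The
  sum then either counts all characters or vanishes; if m is not a unit, every term is 0.\<close>

lemma dchar_orthogonal_dual:
  assumes "q > 0" "coprime n q"
  shows "(\<Sum>chi\<in>dirichlet_chars q. chi m * cnj (chi n)) = (if [m = n] (mod q) then of_nat (totient q) else 0)"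
proof -
  define n' where "n' = n ^ (totient q - 1)"
  have nn: "[n * n' = 1] (mod q)"
    using euler_theorem[OF assms(2)] assms(1) unfolding n'_def
    by (metis Suc_diff_1 power_Suc totient_gt_0_iff)
  have eq: "chi m * cnj (chi n) = chi (m * n')" if "chi \<in> dirichlet_chars q" for chi
  proof -
    have c: "dirichlet_char q chi" using that by (simp add: dirichlet_chars_def)
    have "chi n * chi n' = 1"
      using dchar_cong[OF c nn] dchar_1[OF c] dchar_mult[OF c, of n n'] by simp
    moreover have "chi n * cnj (chi n) = 1"
      using dchar_mult_cnj[OF c] assms by simp
    ultimately have "chi n' = cnj (chi n)"
      by (metis mult_left_cancel mult_zero_left zero_neq_one)
    then show ?thesis using dchar_mult[OF c] by simp
  qed
  have iff: "[m * n' = 1] (mod q) \<longleftrightarrow> [m = n] (mod q)"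
  proof
    assume "[m * n' = 1] (mod q)"
    then have "[m * n' * n = 1 * n] (mod q)" by (rule cong_mult) simp
    moreover have "[m * n' * n = m] (mod q)"
      using cong_mult[OF cong_refl[of m] nn] by (simp add: mult_ac)
    ultimately show "[m = n] (mod q)"
      by (metis cong_sym cong_trans mult_1)
  next
    assume "[m = n] (mod q)"
    then have "[m * n' = n * n'] (mod q)" by (rule cong_mult) simp
    then show "[m * n' = 1] (mod q)" using nn by (rule cong_trans)
  qed
  have "(\<Sum>chi\<in>dirichlet_chars q. chi m * cnj (chi n)) = (\<Sum>chi\<in>dirichlet_chars q. chi (m * n'))"
    using eq by (rule sum.cong[OF refl])
  also have "\<dots> = (if [m * n' = 1] (mod q) then of_nat (totient q) else 0)"
  proof (cases "[m * n' = 1] (mod q)")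
    case True
    have "(\<Sum>chi\<in>dirichlet_chars q. chi (m * n')) = (\<Sum>chi\<in>dirichlet_chars q. 1)"
      using True dchar_cong dchar_1 by (intro sum.cong) (auto simp: dirichlet_chars_def, metis)
    with True show ?thesis using card_dirichlet_chars[OF assms(1)] by simp
  next
    case False
    show ?thesis
    proof (cases "coprime m q")
      case True
      then have "coprime (m * n') q" using assms by (simp add: n'_def)
      with False show ?thesis using assms by (simp add: sum_dchars_eq_0)
    next
      case ncop: False
      then have "chi (m * n') = 0" if "chi \<in> dirichlet_chars q" for chi
        using that by (simp add: dirichlet_chars_def dchar_eq_0_iff)
      with False show ?thesis by (subst sum.neutral) auto
    qed
  qed
  finally show ?thesis by (simp only: iff)
qed

section \<open>Gauss sums and the multiplicative large sieve\<close>

definition primitive_chars :: "nat \<Rightarrow> (nat \<Rightarrow> complex) set" where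
  "primitive_chars r = {psi. dirichlet_char r psi \<and>
     (\<forall>d chi. d dvd r \<longrightarrow> dirichlet_char d chi \<longrightarrow> (\<forall>n. coprime n r \<longrightarrow> psi n = chi n) \<longrightarrow> d = r)}"

lemma primitive_chars_subset: "primitive_chars r \<subseteq> dirichlet_chars r"
  by (auto simp: primitive_chars_def dirichlet_chars_def)

text \<open>Units modulo d lift to units modulo r. With t the product of the primes of r not
  dividing m, every prime of r divides exactly one of m and d * t, hence not their sum.\<close>

lemma coprime_lift:
  fixes m d r :: nat
  assumes "r > 0" "d dvd r" "coprime m d"
  obtains m' where "coprime m' r" "[m' = m] (mod d)"
proof -
  define t where "t = \<Prod>{p \<in> prime_factors r. \<not> p dvd m}"
  have "coprime (m + d * t) r"
  proof (rule ccontr)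
    assume "\<not> coprime (m + d * t) r"
    then have "gcd (m + d * t) r \<noteq> 1"
      by (metis coprime_iff_gcd_eq_1)
    then obtain p where "prime p" "p dvd gcd (m + d * t) r"
      using prime_factor_nat by blast
    then have p: "prime p" "p dvd m + d * t" "p dvd r"
      by auto
    have pt: "p dvd t \<longleftrightarrow> \<not> p dvd m"
    proof
      assume "p dvd t"
      then obtain p' where "p' \<in> prime_factors r" "\<not> p' dvd m" "p dvd p'"
        unfolding t_def using p(1) by (subst (asm) prime_dvd_prod_iff) auto
      then show "\<not> p dvd m" using p(1) by (metis in_prime_factors_imp_prime primes_dvd_imp_eq)
    next
      assume "\<not> p dvd m"
      then have "p \<in> {p \<in> prime_factors r. \<not> p dvd m}"
        using p assms by (auto simp: in_prime_factors_iff)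
      then show "p dvd t" unfolding t_def by (intro dvd_prodI) auto
    qed
    show False
    proof (cases "p dvd m")
      case True
      then have "p dvd d * t" using p(2) by (metis dvd_add_right_iff)
      then have "p dvd d" using pt True p(1) by (metis prime_dvd_mult_iff)
      with True assms(3) p(1) show False
        by (metis coprime_common_divisor not_prime_unit)
    next
      case False
      then have "p dvd d * t" using pt by simp
      then have "p dvd m" using p(2) by (metis dvd_add_left_iff)
      with False show False by simp
    qed
  qed
  moreover have "[m + d * t = m] (mod d)" by (simp add: cong_def)
  ultimately show ?thesis using that by blast
qed

text \<open>If \<open>psi\<close> were trivial on the units that are 1 modulo the proper divisor \<open>d\<close>, it would
  factor through the units modulo \<open>d\<close>.\<close>

lemma primitive_char_nontrivial:
  assumes "psi \<in> primitive_chars r" "d dvd r" "d \<noteq> r"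
  obtains b where "coprime b r" "[b = 1] (mod d)" "psi b \<noteq> 1"
proof (rule ccontr)
  assume "\<not> thesis"
  then have triv: "psi b = 1" if "coprime b r" "[b = 1] (mod d)" for b
    using that \<open>\<And>b. \<lbrakk>coprime b r; [b = 1] (mod d); psi b \<noteq> 1\<rbrakk> \<Longrightarrow> thesis\<close> by blast
  have psi: "dirichlet_char r psi"
    using assms(1) by (simp add: primitive_chars_def)
  have r: "r > 0" using psi by (rule dchar_pos)
  then have d: "d > 0" using assms(2) by (auto intro: Nat.gr0I)
  have cd: "coprime n d" if "coprime n r" for n
    using assms(2) that by (metis coprime_divisors dvd_refl)
  \<comment> \<open>The quotient of two units congruent modulo d is 1 modulo d, where
    \<open>psi\<close> is trivial.\<close>
  have welldef: "psi m = psi n" if "coprime m r" "coprime n r" "[m = n] (mod d)" for m n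
  proof -
    define n' where "n' = n ^ (totient r - 1)"
    have nn: "[n * n' = 1] (mod r)"
      using euler_theorem[OF that(2)] r unfolding n'_def
      by (metis Suc_diff_1 power_Suc totient_gt_0_iff)
    have "[m * n' = n * n'] (mod d)"
      using that(3) by (rule cong_mult) simp
    then have "[m * n' = 1] (mod d)"
      using cong_dvd_modulus_nat[OF nn assms(2)] by (rule cong_trans)
    moreover have "coprime (m * n') r"
      using that by (simp add: n'_def)
    ultimately have "psi (m * n') = 1" using triv by blast
    moreover have "psi (n * n') = 1"
      using dchar_cong[OF psi nn] dchar_1[OF psi] by simp
    ultimately have "psi m * psi n' = psi n * psi n'" "psi n' \<noteq> 0"
      using dchar_mult[OF psi] by auto
    then show ?thesis by simp
  qed
  \<comment> \<open>A choice of lifts to units modulo r; by \<open>welldef\<close> the value of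
    \<open>psi\<close> does not depend on the lift, so \<open>chi\<close> is multiplicative.\<close>
  define l where "l m = (SOME m'. coprime m' r \<and> [m' = m] (mod d))" for m
  have l: "coprime (l m) r" "[l m = m] (mod d)" if "coprime m d" for m
  proof -
    have "\<exists>m'. coprime m' r \<and> [m' = m] (mod d)"
      using coprime_lift[OF r assms(2) that] by blast
    then show "coprime (l m) r" "[l m = m] (mod d)"
      unfolding l_def by (metis (mono_tags, lifting) someI_ex)+
  qed
  define chi where "chi m = (if coprime m d then psi (l m) else 0)" for m
  have chi_eq: "chi n = psi n'" if "coprime n' r" "[n' = n] (mod d)" for n n'
  proof -
    have "coprime n d"
      using cd[OF that(1)] cong_imp_coprime[OF that(2)] by simp
    then show ?thesis
      unfolding chi_def using l[of n] that by (metis cong_sym cong_trans welldef)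
  qed
  have "dirichlet_char d chi"
    unfolding dirichlet_char_def
  proof (intro conjI allI)
    fix n show "chi (n + d) = chi n"
    proof (cases "coprime n d")
      case True
      then show ?thesis
        using l[OF True] chi_eq[of "l n" n] chi_eq[of "l n" "n + d"] by (simp add: cong_def)
    next
      case False
      then have "\<not> coprime (n + d) d" by (simp only: coprime_iff_gcd_eq_1 gcd_add1 not_False_eq_True)
      with False show ?thesis by (simp add: chi_def)
    qed
  next
    fix m n show "chi (m * n) = chi m * chi n"
    proof (cases "coprime m d \<and> coprime n d")
      case True
      then have "chi (m * n) = psi (l m * l n)"
        using l by (intro chi_eq cong_mult) auto
      then show ?thesis using True by (simp add: chi_def dchar_mult[OF psi])
    qed (auto simp: chi_def)
  next
    show "chi 1 = 1" using chi_eq[of 1 1] dchar_1[OF psi] by simp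
  next
    fix n show "chi n = 0 \<longleftrightarrow> \<not> coprime n d"
      using l(1)[of n] dchar_eq_0_iff[OF psi] by (simp add: chi_def)
  qed (use d in simp)
  moreover have "\<forall>n. coprime n r \<longrightarrow> psi n = chi n"
    using chi_eq by (metis cong_refl)
  ultimately have "d = r"
    using assms(1,2) by (auto simp: primitive_chars_def)
  with assms(3) show False ..
qed

section \<open>Gauss sums\<close>

definition gauss_sum :: "nat \<Rightarrow> (nat \<Rightarrow> complex) \<Rightarrow> nat \<Rightarrow> complex" where
  "gauss_sum r psi n = (\<Sum>a\<in>units_mod r. cnj (psi a) * ee r (a * n))"

lemma gauss_sum_shift:
  assumes "dirichlet_char r psi" "coprime b r"
  shows "gauss_sum r psi n = cnj (psi b) * gauss_sum r psi (b * n)"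
proof -
  have r: "r > 0" using assms(1) by (rule dchar_pos)
  have "gauss_sum r psi n = (\<Sum>a\<in>units_mod r. cnj (psi (a * b)) * ee r ((a * b) * n))"
    unfolding gauss_sum_def
  proof (rule sum_units_mod_mult[OF assms(2) r, symmetric])
    fix a
    have "ee r (a mod r * n) = ee r (a * n)"
      by (subst ee_eq_iff[OF r]) (simp add: cong_def mod_mult_left_eq)
    then show "cnj (psi (a mod r)) * ee r (a mod r * n) = cnj (psi a) * ee r (a * n)"
      by (simp add: dchar_mod[OF assms(1)])
  qed
  then show ?thesis
    by (simp add: gauss_sum_def dchar_mult[OF assms(1)] sum_distrib_left mult_ac)
qed

text \<open>For a unit n, substitute in the sum. Otherwise n / r has a proper divisor d of r as
  reduced denominator; an element b that is 1 modulo d with psi(b) not 1 satisfies b * n = n modulo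
  r, so the shift by b forces the sum to vanish, as psi(n) does.\<close>

lemma gauss_sum_primitive:
  assumes "psi \<in> primitive_chars r"
  shows "gauss_sum r psi n = psi n * gauss_sum r psi 1"
proof -
  have psi: "dirichlet_char r psi"
    using assms by (simp add: primitive_chars_def)
  have r: "r > 0" using psi by (rule dchar_pos)
  show ?thesis
  proof (cases "coprime n r")
    case True
    have "psi n * gauss_sum r psi 1 = (psi n * cnj (psi n)) * gauss_sum r psi n"
      using gauss_sum_shift[OF psi True, of 1] by simp
    with True show ?thesis by (simp add: dchar_mult_cnj[OF psi])
  next
    case False
    define d where "d = r div gcd n r"
    have dr: "r = d * gcd n r" by (simp add: d_def)
    then have "d dvd r" by (metis dvd_triv_left)
    moreover have "d \<noteq> r"
      using False r dr by (metis coprime_iff_gcd_eq_1 mult_cancel1 mult_1_right neq0_conv)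
    ultimately obtain b where b: "coprime b r" "[b = 1] (mod d)" "psi b \<noteq> 1"
      using primitive_char_nontrivial[OF assms] by blast
    have "[b * gcd n r = 1 * gcd n r] (mod (d * gcd n r))"
      using b(2) r by (simp add: cong_def mod_mult_mult2)
    then have "[b * gcd n r = gcd n r] (mod r)"
      using dr by simp
    then have "[b * gcd n r * (n div gcd n r) = gcd n r * (n div gcd n r)] (mod r)"
      by (rule cong_mult) simp
    then have bn: "[b * n = n] (mod r)"
      by (simp add: mult.assoc)
    have "gauss_sum r psi (b * n) = gauss_sum r psi n"
      unfolding gauss_sum_def
      by (intro sum.cong refl arg_cong2[where f = "(*)"]) (simp add: ee_eq_iff[OF r] cong_mult[OF cong_refl bn])
    then have "gauss_sum r psi n = cnj (psi b) * gauss_sum r psi n"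
      using gauss_sum_shift[OF psi b(1), of n] by simp
    moreover have "cnj (psi b) \<noteq> 1" using b(3) by simp
    ultimately have "gauss_sum r psi n = 0" by simp
    with False show ?thesis by (simp add: dchar_eq_0_iff[OF psi])
  qed
qed

text \<open>The mean square of \<open>gauss_sum r psi n\<close> over n modulo r is computed twice:
  by Parseval, and by pulling out the factor psi(n).\<close>

lemma norm_gauss_sum_primitive:
  assumes "psi \<in> primitive_chars r"
  shows "(cmod (gauss_sum r psi 1))\<^sup>2 = real r"
proof -
  have psi: "dirichlet_char r psi"
    using assms by (simp add: primitive_chars_def)
  have r: "r > 0" using psi by (rule dchar_pos)
  have norm_psi: "(\<Sum>n\<in>units_mod r. (cmod (psi n))\<^sup>2) = real (totient r)"
  proof -
    have "(\<Sum>n\<in>units_mod r. (cmod (psi n))\<^sup>2) = (\<Sum>n\<in>units_mod r. 1)"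
      by (intro sum.cong) (auto simp: norm_dchar[OF psi] units_mod_def)
    then show ?thesis using card_units_mod[OF r] by simp
  qed
  have "real r * real (totient r) = (\<Sum>n<r. (cmod (\<Sum>a\<in>units_mod r. cnj (psi a) * ee r (n * a)))\<^sup>2)"
    using parseval_ee[OF r finite_units_mod[of r], of "\<lambda>a. cnj (psi a)"] norm_psi
    by (simp add: inj_on_def units_mod_def)
  also have "\<dots> = (\<Sum>n<r. (cmod (psi n))\<^sup>2 * (cmod (gauss_sum r psi 1))\<^sup>2)"
    using gauss_sum_primitive[OF assms]
    by (simp add: gauss_sum_def mult.commute[of _ "_ :: nat"] norm_mult power_mult_distrib)
  also have "\<dots> = (\<Sum>n<r. (cmod (psi n))\<^sup>2) * (cmod (gauss_sum r psi 1))\<^sup>2"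
    by (simp add: sum_distrib_right)
  also have "(\<Sum>n<r. (cmod (psi n))\<^sup>2) = (\<Sum>n\<in>units_mod r. (cmod (psi n))\<^sup>2)"
    by (rule sum.mono_neutral_right) (auto simp: units_mod_def dchar_eq_0_iff[OF psi])
  finally have "real (totient r) * real r = real (totient r) * (cmod (gauss_sum r psi 1))\<^sup>2"
    unfolding norm_psi by (simp only: mult.commute)
  then show ?thesis
    using r by (subst (asm) mult_cancel_left) simp
qed

text \<open>Multiplying by the Gauss sum, of squared modulus r, converts the character sum into a
  combination of exponential sums. By positivity the sum extends to all characters modulo r, where
  orthogonality applies.\<close>

lemma primitive_char_sum_bound:
  fixes c :: "nat \<Rightarrow> complex"
  assumes "r > 0"
  shows "real r / real (totient r) * (\<Sum>psi\<in>primitive_chars r. (cmod (\<Sum>n=1..N. c n * psi n))\<^sup>2)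
    \<le> (\<Sum>a\<in>units_mod r. (cmod (\<Sum>n=1..N. c n * ee r (a * n)))\<^sup>2)"
proof -
  define x where "x a = (\<Sum>n=1..N. c n * ee r (a * n))" for a
  have "real r * (cmod (\<Sum>n=1..N. c n * psi n))\<^sup>2 = (cmod (\<Sum>a\<in>units_mod r. x a * cnj (psi a)))\<^sup>2"
    if "psi \<in> primitive_chars r" for psi
  proof -
    have "(\<Sum>n=1..N. c n * psi n) * gauss_sum r psi 1 = (\<Sum>n=1..N. c n * gauss_sum r psi n)"
      unfolding sum_distrib_right mult.assoc
      by (intro sum.cong refl arg_cong2[where f = "(*)"] gauss_sum_primitive[OF that, symmetric])
    also have "\<dots> = (\<Sum>n=1..N. \<Sum>a\<in>units_mod r. c n * ee r (a * n) * cnj (psi a))"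
      by (simp add: gauss_sum_def sum_distrib_left mult_ac)
    also have "\<dots> = (\<Sum>a\<in>units_mod r. x a * cnj (psi a))"
      by (subst sum.swap) (simp add: x_def sum_distrib_right)
    finally have *: "(\<Sum>n=1..N. c n * psi n) * gauss_sum r psi 1 = (\<Sum>a\<in>units_mod r. x a * cnj (psi a))" .
    show ?thesis
      unfolding *[symmetric] norm_mult power_mult_distrib norm_gauss_sum_primitive[OF that] by (rule mult.commute)
  qed
  then have "real r * (\<Sum>psi\<in>primitive_chars r. (cmod (\<Sum>n=1..N. c n * psi n))\<^sup>2)
      = (\<Sum>psi\<in>primitive_chars r. (cmod (\<Sum>a\<in>units_mod r. x a * cnj (psi a)))\<^sup>2)"
    by (simp add: sum_distrib_left)
  also have "\<dots> \<le> (\<Sum>psi\<in>dirichlet_chars r. (cmod (\<Sum>a\<in>units_mod r. x a * cnj (psi a)))\<^sup>2)"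
    by (intro sum_mono2 primitive_chars_subset) auto
  also have "\<dots> = real (totient r) * (\<Sum>a\<in>units_mod r. (cmod (x a))\<^sup>2)"
  proof (rule parseval_orthogonal)
    fix m n assume mn: "m \<in> units_mod r" "n \<in> units_mod r"
    have "(\<Sum>psi\<in>dirichlet_chars r. cnj (psi m) * cnj (cnj (psi n))) = cnj (\<Sum>psi\<in>dirichlet_chars r. psi m * cnj (psi n))"
      by simp
    also have "\<dots> = (if m = n then of_real (real (totient r)) else 0)"
      using mn assms by (subst dchar_orthogonal_dual) (auto simp: units_mod_def cong_def)
    finally show "(\<Sum>psi\<in>dirichlet_chars r. cnj (psi m) * cnj (cnj (psi n))) = (if m = n then of_real (real (totient r)) else 0)" .
  qed simp
  finally show ?thesis
    using assms by (simp add: x_def field_simps)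
qed

lemma multiplicative_large_sieve:
  fixes c :: "nat \<Rightarrow> complex"
  shows "(\<Sum>r=1..R. real r / real (totient r) * (\<Sum>psi\<in>primitive_chars r. (cmod (\<Sum>n=1..N. c n * psi n))\<^sup>2))
    \<le> 4 * (real R ^ 2 + 6 * real N) * (\<Sum>n=1..N. (cmod (c n))\<^sup>2)"
proof -
  have "(\<Sum>r=1..R. real r / real (totient r) * (\<Sum>psi\<in>primitive_chars r. (cmod (\<Sum>n=1..N. c n * psi n))\<^sup>2))
      \<le> (\<Sum>r=1..R. \<Sum>a\<in>units_mod r. (cmod (\<Sum>n=1..N. c n * ee r (a * n)))\<^sup>2)"
    by (intro sum_mono primitive_char_sum_bound) auto
  also note additive_large_sieve
  finally show ?thesis .
qed

section \<open>Reciprocals of the totient function\<close>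

lemma telescope_reciprocal:
  assumes "n > 0"
  shows "1 / real n - 1 / real (Suc n) = 1 / (real n * real (Suc n))"
  using assms by (simp add: diff_frac_eq)

text \<open>Partial summation as an induction on Q. Replacing F / Q by F / (Q + 1) costs at most A,
  since Q^2 / (Q * (Q + 1)) \<le> 1, plus a telescoping multiple of B.\<close>

lemma sum_reciprocal_weights_le:
  fixes t :: "nat \<Rightarrow> real"
  assumes "m > 0" "m \<le> Q" "A \<ge> 0" "\<And>R. (\<Sum>r=m..R. t r) \<le> A * real R ^ 2 + B"
  shows "(\<Sum>r=m..Q. t r / real r) \<le> (\<Sum>r=m..Q. t r) / real Q + A * (real Q - real m) + B * (1 / real m - 1 / real Q)"
  using assms(2)
proof (induction Q rule: dec_induct)
  case (step Q)
  have Q: "Q > 0" using step assms(1) by simp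
  define F where "F = (\<Sum>r=m..Q. t r)"
  have "F * (1 / real Q - 1 / real (Suc Q)) \<le> (A * real Q ^ 2 + B) * (1 / real Q - 1 / real (Suc Q))"
    unfolding F_def using Q by (intro mult_right_mono assms(4)) (auto simp: field_simps)
  also have "\<dots> \<le> A * real Q ^ 2 * (1 / real Q - 1 / real (Suc Q)) + B * (1 / real Q - 1 / real (Suc Q))"
    by (simp only: distrib_right order.refl)
  finally have *: "F * (1 / real Q - 1 / real (Suc Q)) \<le> A * real Q ^ 2 * (1 / real Q - 1 / real (Suc Q)) + B * (1 / real Q - 1 / real (Suc Q))" .
  have "real Q ^ 2 * (1 / real Q - 1 / real (Suc Q)) \<le> 1"
    unfolding telescope_reciprocal[OF Q] using Q by (simp add: power2_eq_square divide_le_eq)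
  then have "A * real Q ^ 2 * (1 / real Q - 1 / real (Suc Q)) \<le> A"
    using assms(3) by (metis mult.assoc mult_left_mono mult_1_right)
  with * have "F * (1 / real Q - 1 / real (Suc Q)) \<le> A + B * (1 / real Q - 1 / real (Suc Q))"
    by simp
  then have "F / real Q \<le> F / real (Suc Q) + A + (B / real Q - B / real (Suc Q))"
    by (simp add: right_diff_distrib)
  then show ?case
    using step.IH step.hyps by (simp add: F_def[symmetric] add_divide_distrib right_diff_distrib ring_distribs)
qed simp

text \<open>Including all integers from 2 to n only lowers the product, which then telescopes to (n
  + 1) / (2 * n).\<close>

lemma prod_one_minus_inverse_square_ge:
  fixes A :: "nat set"
  assumes "finite A" "A \<subseteq> {2..}"
  shows "(\<Prod>p\<in>A. 1 - 1 / real p ^ 2) \<ge> 1 / 2"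
proof -
  obtain n where n: "A \<subseteq> {2..n}" "n \<ge> 1"
  proof
    show "A \<subseteq> {2..Suc (Max A)}"
      using assms by (auto intro!: le_SucI)
  qed simp
  have "(\<Prod>p=2..n. 1 - 1 / real p ^ 2) = (real n + 1) / (2 * real n)"
    using n(2)
  proof (induction n rule: dec_induct)
    case (step n)
    then have "(\<Prod>p=2..Suc n. 1 - 1 / real p ^ 2) = (real n + 1) / (2 * real n) * (1 - 1 / (real n + 1) ^ 2)"
      by (simp add: add.commute)
    also have "1 - 1 / (real n + 1) ^ 2 = real n * (real n + 2) / (real n + 1) ^ 2"
      by (simp add: divide_simps) (simp add: algebra_simps power2_eq_square)
    finally show ?case using step by (simp add: power2_eq_square add.commute)
  qed simp
  then have "1 / 2 \<le> (\<Prod>p=2..n. 1 - 1 / real p ^ 2)"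
    using n(2) by (simp only:) (simp add: divide_simps)
  also have "\<dots> = (\<Prod>p\<in>{2..n} - A. 1 - 1 / real p ^ 2) * (\<Prod>p\<in>A. 1 - 1 / real p ^ 2)"
    using n(1) by (intro prod.subset_diff) auto
  also have "\<dots> \<le> 1 * (\<Prod>p\<in>A. 1 - 1 / real p ^ 2)"
    using assms by (intro mult_right_mono prod_le_1 prod_nonneg) auto
  finally show ?thesis by simp
qed

text \<open>Multiplying out: a new prime p adds to each divisor d the divisor p * d, and these are
  new because p does not divide the old product.\<close>

lemma prod_primes_le_divisor_sum:
  fixes A :: "nat set"
  assumes "finite A" "\<And>p. p \<in> A \<Longrightarrow> prime p"
  shows "(\<Prod>p\<in>A. 1 + 1 / real p) \<le> (\<Sum>d | d dvd \<Prod>A. 1 / real d)"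
  using assms
proof (induction A)
  case (insert p A)
  have pos: "\<Prod>A > 0" using insert by (intro prod_pos) (auto intro: prime_gt_0_nat)
  have p: "prime p" using insert by simp
  have cop: "\<not> p dvd \<Prod>A"
    using insert by (metis insertCI prime_dvd_prod_iff primes_dvd_imp_eq)
  have fin: "finite {d. d dvd \<Prod>A}" using pos by simp
  have "(\<Prod>p\<in>insert p A. 1 + 1 / real p) \<le> (1 + 1 / real p) * (\<Sum>d | d dvd \<Prod>A. 1 / real d)"
    using insert by (auto intro!: mult_left_mono)
  also have "\<dots> = (\<Sum>d | d dvd \<Prod>A. 1 / real d) + (\<Sum>d | d dvd \<Prod>A. 1 / real (p * d))"
    by (simp only: distrib_right mult_1 sum_distrib_left times_divide_times_eq of_nat_mult sum.distrib)
  also have "(\<Sum>d | d dvd \<Prod>A. 1 / real (p * d)) = (\<Sum>d\<in>(*) p ` {d. d dvd \<Prod>A}. 1 / real d)"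
    using p by (subst sum.reindex) (auto simp: inj_on_def)
  also have "(\<Sum>d | d dvd \<Prod>A. 1 / real d) + (\<Sum>d\<in>(*) p ` {d. d dvd \<Prod>A}. 1 / real d)
      = (\<Sum>d\<in>{d. d dvd \<Prod>A} \<union> (*) p ` {d. d dvd \<Prod>A}. 1 / real d)"
    using fin cop by (subst sum.union_disjoint) (auto dest: dvd_mult_left)
  also have "\<dots> \<le> (\<Sum>d | d dvd \<Prod>(insert p A). 1 / real d)"
  proof (rule sum_mono2)
    show "finite {d. d dvd \<Prod>(insert p A)}"
      using insert pos p by (intro finite_divisors_nat) (simp add: prime_gt_0_nat)
  qed (use insert in auto)
  finally show ?case .
qed simp

text \<open>By Euler's product, n / phi(n) is the product of 1 / (1 - 1/p). This is at most twice
  the product of 1 + 1/p, because the factors 1 - 1/p^2 multiply to at least 1/2.\<close>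

lemma inverse_totient_le:
  assumes "n > 0"
  shows "1 / real (totient n) \<le> 2 / real n * (\<Sum>d | d dvd n. 1 / real d)"
proof -
  let ?P = "prime_factors n"
  have gt1: "real p > 1" if "p \<in> ?P" for p
    using that by (metis in_prime_factors_imp_prime of_nat_1 of_nat_less_iff prime_gt_1_nat)
  have tot: "real (totient n) = real n * (\<Prod>p\<in>?P. 1 - 1 / real p)"
    using totient_formula2[of n] by (simp add: inverse_eq_divide)
  have "1 / 2 \<le> (\<Prod>p\<in>?P. 1 - 1 / real p ^ 2)"
    by (intro prod_one_minus_inverse_square_ge) (auto intro: prime_ge_2_nat)
  also have "\<dots> = (\<Prod>p\<in>?P. 1 - 1 / real p) * (\<Prod>p\<in>?P. 1 + 1 / real p)"
    unfolding prod.distrib[symmetric]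
    by (intro prod.cong) (auto simp: algebra_simps power2_eq_square)
  also have "\<dots> \<le> (\<Prod>p\<in>?P. 1 - 1 / real p) * (\<Sum>d | d dvd n. 1 / real d)"
  proof (intro mult_left_mono prod_nonneg)
    have "(\<Prod>p\<in>?P. 1 + 1 / real p) \<le> (\<Sum>d | d dvd \<Prod>?P. 1 / real d)"
      by (intro prod_primes_le_divisor_sum) auto
    also have "\<dots> \<le> (\<Sum>d | d dvd n. 1 / real d)"
    proof (rule sum_mono2)
      have "\<Prod>?P dvd n"
      proof -
        have "\<Prod>?P dvd (\<Prod>p\<in>?P. p ^ multiplicity p n)"
          by (intro prod_dvd_prod) (auto intro!: dvd_power prime_factors_multiplicity simp: prime_factors_multiplicity)
        also have "\<dots> = n"
          using prime_factorization_nat[of n] assms by simp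
        finally show ?thesis .
      qed
      then show "{d. d dvd \<Prod>?P} \<subseteq> {d. d dvd n}" by (auto intro: dvd_trans)
    qed (use assms in auto)
    finally show "(\<Prod>p\<in>?P. 1 + 1 / real p) \<le> (\<Sum>d | d dvd n. 1 / real d)" .
  qed (use gt1 in force)
  finally have "1 / 2 * real n \<le> real (totient n) * (\<Sum>d | d dvd n. 1 / real d)"
    using assms by (simp add: tot)
  then show ?thesis
    using assms by (simp add: field_simps)
qed

lemma sum_inverse_squares_le: "(\<Sum>d=1..n. 1 / real d ^ 2) \<le> 2"
proof -
  \<comment> \<open>Subtracting 1 / n makes the induction telescope.\<close>
  have "(\<Sum>d=1..n. 1 / real d ^ 2) \<le> 2 - 1 / real n"
  proof (induction n)
    case (Suc n)
    show ?case
    proof (cases "n = 0")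
      case False
      then have "1 / real (Suc n) ^ 2 \<le> 1 / real n - 1 / real (Suc n)"
        by (subst telescope_reciprocal) (auto simp: power2_eq_square intro!: divide_left_mono mult_right_mono)
      with Suc show ?thesis by simp
    qed simp
  qed simp
  then show ?thesis by (smt (verit) divide_nonneg_nonneg of_nat_0_le_iff)
qed

text \<open>Writing s = d * m separates the bound into the sums of 1 / d^2 and 1 / m. The constant
  is 2 * 2 * 3, the 3 coming from ln Q + 1 \<le> 3 * ln Q for Q \<ge> 2.\<close>

lemma sum_inverse_totient_le:
  assumes "Q \<ge> 2"
  shows "(\<Sum>s=1..Q. 1 / real (totient s)) \<le> 12 * ln (real Q)"
proof -
  have "(\<Sum>s=1..Q. 1 / real (totient s)) \<le> (\<Sum>s=1..Q. \<Sum>d | d dvd s. 2 / (real s * real d))"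
    by (intro sum_mono) (use inverse_totient_le in \<open>simp add: sum_distrib_left\<close>)
  also have "\<dots> = (\<Sum>(s, d)\<in>(SIGMA s:{1..Q}. {d. d dvd s}). 2 / (real s * real d))"
    by (rule sum.Sigma) auto
  also have "\<dots> \<le> (\<Sum>(d, m)\<in>{1..Q} \<times> {1..Q}. 2 / (real d ^ 2 * real m))"
  proof (rule sum_le_included[where i = "\<lambda>(d, m). (d * m, d)"])
    show "\<forall>x\<in>SIGMA s:{1..Q}. {d. d dvd s}. \<exists>y\<in>{1..Q} \<times> {1..Q}. (\<lambda>(d, m). (d * m, d)) y = x \<and>
        (case x of (s, d) \<Rightarrow> 2 / (real s * real d)) \<le> (case y of (d, m) \<Rightarrow> 2 / (real d ^ 2 * real m))"
    proof clarify
      fix s d assume s: "s \<in> {1..Q}" "d dvd s"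
      then obtain m where m: "s = d * m" by blast
      have "d > 0" "m > 0"
        using s m by (auto intro: Nat.gr0I)
      then have "d \<le> Q" "m \<le> Q"
        using s m by (auto intro: order.trans[rotated])
      then show "\<exists>y\<in>{1..Q} \<times> {1..Q}. (\<lambda>(d, m). (d * m, d)) y = (s, d) \<and>
         2 / (real s * real d) \<le> (case y of (d, m) \<Rightarrow> 2 / (real d ^ 2 * real m))"
        using s m by (intro bexI[of _ "(d, m)"]) (auto simp: power2_eq_square mult_ac)
    qed
  qed (auto intro!: divide_nonneg_nonneg)
  also have "\<dots> = 2 * ((\<Sum>d=1..Q. 1 / real d ^ 2) * (\<Sum>m=1..Q. 1 / real m))"
    unfolding sum_product sum.cartesian_product[symmetric] unfolding sum_distrib_left
    by simp
  also have "\<dots> \<le> 2 * (2 * (\<Sum>m=1..Q. 1 / real m))"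
    using sum_inverse_squares_le by (intro mult_left_mono mult_right_mono sum_nonneg) auto
  also have "(\<Sum>m=1..Q. 1 / real m) = harm Q"
    by (simp add: harm_def inverse_eq_divide)
  also have "harm Q \<le> ln (real Q) + 1"
    using euler_mascheroni_sequence_decreasing[of 1 Q] assms by (simp add: harm_def)
  also have "ln (real Q) + 1 \<le> 3 * ln (real Q)"
  proof -
    have "1 / 2 \<le> ln (2 :: real)" using ln2_ge_two_thirds by simp
    also have "\<dots> \<le> ln (real Q)" using assms by simp
    finally show ?thesis by simp
  qed
  finally show ?thesis by simp
qed

section \<open>The mean square of the error term\<close>

lemma tau_pos:
  assumes "n > 0"
  shows "tau n > 0"
proof -
  have "finite {d. d dvd n}" "n \<in> {d. d dvd n}" using assms by auto
  then show ?thesis unfolding tau_def by (metis card_gt_0_iff empty_iff)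
qed

lemma tau_mult_le:
  assumes "m > 0" "n > 0"
  shows "tau (m * n) \<le> tau m * tau n"
proof -
  have fin: "finite ({d. d dvd m} \<times> {d. d dvd n})" using assms by simp
  have "{d. d dvd m * n} \<subseteq> (\<lambda>(a, b). a * b) ` ({d. d dvd m} \<times> {d. d dvd n})"
  proof
    fix d assume "d \<in> {d. d dvd m * n}"
    then obtain a b where "d = a * b" "a dvd m" "b dvd n"
      using division_decomp by blast
    then show "d \<in> (\<lambda>(a, b). a * b) ` ({d. d dvd m} \<times> {d. d dvd n})" by auto
  qed
  then have "tau (m * n) \<le> card ((\<lambda>(a, b). a * b) ` ({d. d dvd m} \<times> {d. d dvd n}))"
    unfolding tau_def using fin by (intro card_mono finite_imageI)
  also have "\<dots> \<le> card ({d. d dvd m} \<times> {d. d dvd n})"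
    using fin by (rule card_image_le)
  finally show ?thesis by (simp add: tau_def card_cartesian_product)
qed

text \<open>Conjugating the sum over n2 does not change its modulus; it moves the conjugation from
  chi to \<open>\<delta>\<close>, so that the two sums merge into one over n = n1 * n2.\<close>

definition conv_coeff :: "(nat \<Rightarrow> complex) \<Rightarrow> (nat \<Rightarrow> complex) \<Rightarrow> nat \<Rightarrow> nat \<Rightarrow> nat \<Rightarrow> complex" where
  "conv_coeff \<gamma> \<delta> N1 N2 n =
     (\<Sum>(n1, n2) | n1 \<in> {1..N1} \<and> n2 \<in> {1..N2} \<and> n1 * n2 = n. \<gamma> n1 * cnj (\<delta> n2))"

lemma sum_factorizations:
  fixes h :: "nat \<Rightarrow> nat \<Rightarrow> 'a :: comm_monoid_add"
  shows "(\<Sum>n=1..N1 * N2. \<Sum>(n1, n2) | n1 \<in> {1..N1} \<and> n2 \<in> {1..N2} \<and> n1 * n2 = n. h n1 n2)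
    = (\<Sum>n1=1..N1. \<Sum>n2=1..N2. h n1 n2)"
proof -
  have "(\<Sum>n\<in>{1..N1 * N2}. \<Sum>p\<in>{p \<in> {1..N1} \<times> {1..N2}. fst p * snd p = n}. h (fst p) (snd p))
      = (\<Sum>p\<in>{1..N1} \<times> {1..N2}. h (fst p) (snd p))"
    by (rule sum.group) (auto simp: Suc_le_eq intro: mult_le_mono)
  moreover have "{(n1, n2). n1 \<in> {1..N1} \<and> n2 \<in> {1..N2} \<and> n1 * n2 = n}
      = {p \<in> {1..N1} \<times> {1..N2}. fst p * snd p = n}" for n
    by auto
  ultimately show ?thesis
    by (simp add: sum.cartesian_product split_def)
qed

lemma sum_conv_coeff:
  "(\<Sum>n=1..N1 * N2. conv_coeff \<gamma> \<delta> N1 N2 n * f n)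
    = (\<Sum>n1=1..N1. \<Sum>n2=1..N2. \<gamma> n1 * cnj (\<delta> n2) * f (n1 * n2))"
proof -
  have "(\<Sum>n=1..N1 * N2. conv_coeff \<gamma> \<delta> N1 N2 n * f n)
    = (\<Sum>n=1..N1 * N2. \<Sum>(n1, n2) | n1 \<in> {1..N1} \<and> n2 \<in> {1..N2} \<and> n1 * n2 = n.
        \<gamma> n1 * cnj (\<delta> n2) * f (n1 * n2))"
    unfolding conv_coeff_def sum_distrib_right by (intro sum.cong refl) auto
  then show ?thesis by (simp only: sum_factorizations)
qed

text \<open>Cauchy-Schwarz over the factorizations of n, of which there are at most
  \<open>tau n\<close>.\<close>

lemma norm_conv_coeff_le:
  assumes "n > 0"
  shows "(cmod (conv_coeff \<gamma> \<delta> N1 N2 n))\<^sup>2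
    \<le> (\<Sum>(n1, n2) | n1 \<in> {1..N1} \<and> n2 \<in> {1..N2} \<and> n1 * n2 = n.
         real (tau (n1 * n2)) * ((cmod (\<gamma> n1))\<^sup>2 * (cmod (\<delta> n2))\<^sup>2))"
proof -
  let ?A = "{(n1, n2). n1 \<in> {1..N1} \<and> n2 \<in> {1..N2} \<and> n1 * n2 = n}"
  let ?g = "\<lambda>p. cmod (\<gamma> (fst p)) * cmod (\<delta> (snd p))"
  have "card ?A = card (fst ` ?A)"
    using assms by (intro card_image[symmetric] inj_onI) auto
  also have "\<dots> \<le> tau n"
    unfolding tau_def using assms by (intro card_mono) auto
  finally have card: "card ?A \<le> tau n" .
  have "cmod (conv_coeff \<gamma> \<delta> N1 N2 n) \<le> (\<Sum>p\<in>?A. ?g p)"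
    unfolding conv_coeff_def by (rule order.trans[OF norm_sum]) (auto simp: norm_mult split_def)
  then have "(cmod (conv_coeff \<gamma> \<delta> N1 N2 n))\<^sup>2 \<le> (\<Sum>p\<in>?A. ?g p)\<^sup>2"
    by (intro power_mono) auto
  also have "\<dots> \<le> (\<Sum>p\<in>?A. (?g p)\<^sup>2) * real (card ?A)"
    by (rule sum_squared_le_sum_of_squares)
  also have "\<dots> \<le> (\<Sum>p\<in>?A. (?g p)\<^sup>2) * real (tau n)"
    using card by (intro mult_left_mono sum_nonneg) auto
  also have "\<dots> = (\<Sum>p\<in>?A. real (tau (fst p * snd p)) * ((cmod (\<gamma> (fst p)))\<^sup>2 * (cmod (\<delta> (snd p)))\<^sup>2))"
    unfolding sum_distrib_right by (intro sum.cong) (auto simp: power_mult_distrib)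
  finally show ?thesis by (simp add: split_def)
qed

lemma tau_norm2_eq:
  assumes "\<forall>n. (n = 0 \<or> n > N) \<longrightarrow> c n = 0"
  shows "tau_norm2 c = (\<Sum>n=1..N. (cmod (c n))\<^sup>2 * (real (tau n))\<^sup>2)"
  unfolding tau_norm2_def
proof (rule sum.mono_neutral_left)
  show "{n. c n \<noteq> 0} \<subseteq> {1..N}"
  proof
    fix n assume "n \<in> {n. c n \<noteq> 0}"
    with assms have "\<not> (n = 0 \<or> n > N)" by blast
    then show "n \<in> {1..N}" by auto
  qed
qed auto

lemma conv_coeff_norm2_le:
  assumes "\<forall>n. (n = 0 \<or> n > N1) \<longrightarrow> \<gamma> n = 0" "\<forall>n. (n = 0 \<or> n > N2) \<longrightarrow> \<delta> n = 0"
  shows "(\<Sum>n=1..N1 * N2. (cmod (conv_coeff \<gamma> \<delta> N1 N2 n))\<^sup>2) \<le> tau_norm2 \<gamma> * tau_norm2 \<delta>"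
proof -
  have "(\<Sum>n=1..N1 * N2. (cmod (conv_coeff \<gamma> \<delta> N1 N2 n))\<^sup>2)
      \<le> (\<Sum>n=1..N1 * N2. \<Sum>(n1, n2) | n1 \<in> {1..N1} \<and> n2 \<in> {1..N2} \<and> n1 * n2 = n.
         real (tau (n1 * n2)) * ((cmod (\<gamma> n1))\<^sup>2 * (cmod (\<delta> n2))\<^sup>2))"
    by (intro sum_mono norm_conv_coeff_le) auto
  also have "\<dots> = (\<Sum>n1=1..N1. \<Sum>n2=1..N2. real (tau (n1 * n2)) * ((cmod (\<gamma> n1))\<^sup>2 * (cmod (\<delta> n2))\<^sup>2))"
    by (rule sum_factorizations)
  also have "\<dots> \<le> (\<Sum>n1=1..N1. \<Sum>n2=1..N2.
      ((real (tau n1))\<^sup>2 * (real (tau n2))\<^sup>2) * ((cmod (\<gamma> n1))\<^sup>2 * (cmod (\<delta> n2))\<^sup>2))"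
  proof (intro sum_mono mult_right_mono)
    fix n1 n2 assume n: "n1 \<in> {1..N1}" "n2 \<in> {1..N2}"
    have "tau (n1 * n2) \<le> tau n1 * tau n2"
      using n by (intro tau_mult_le) auto
    \<comment> \<open>A positive integer is at most its square, which matches the squared divisor
      function in the norms.\<close>
    also have "\<dots> \<le> (tau n1 * tau n2)\<^sup>2"
      by (rule self_le_power) (use n tau_pos[of n1] tau_pos[of n2] in auto)
    finally show "real (tau (n1 * n2)) \<le> (real (tau n1))\<^sup>2 * (real (tau n2))\<^sup>2"
      by (metis of_nat_le_iff of_nat_mult of_nat_power power_mult_distrib)
  qed auto
  also have "\<dots> = tau_norm2 \<gamma> * tau_norm2 \<delta>"
    unfolding tau_norm2_eq[OF assms(1)] tau_norm2_eq[OF assms(2)] sum_product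
    by (intro sum.cong refl) (simp only: mult_ac)
  finally show ?thesis .
qed

section \<open>Conductors and inducing characters\<close>

context
  fixes q :: nat and chi :: "nat \<Rightarrow> complex"
  assumes chi: "dirichlet_char q chi"
begin

lemma conductor_least:
  assumes "d dvd q" "dirichlet_char d psi" "\<And>n. coprime n q \<Longrightarrow> chi n = psi n"
  shows "conductor q chi \<le> d"
  unfolding conductor_def
  by (intro Least_le conjI exI[of _ psi] assms allI impI)

text \<open>If the character at the least modulus came from a smaller divisor, so would chi, against
  minimality.\<close>

lemma primitive_inducing:
  obtains psi where "conductor q chi dvd q" "psi \<in> primitive_chars (conductor q chi)"
    "\<And>n. coprime n q \<Longrightarrow> chi n = psi n"
proof -
  have "\<exists>d. d dvd q \<and> (\<exists>psi. dirichlet_char d psi \<and> (\<forall>n. coprime n q \<longrightarrow> chi n = psi n))"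
    by (intro exI[of _ q] conjI exI[of _ chi] chi) auto
  then have "conductor q chi dvd q \<and> (\<exists>psi. dirichlet_char (conductor q chi) psi \<and> (\<forall>n. coprime n q \<longrightarrow> chi n = psi n))"
    unfolding conductor_def by (rule LeastI_ex)
  then obtain psi where psi: "conductor q chi dvd q" "dirichlet_char (conductor q chi) psi"
    "\<And>n. coprime n q \<Longrightarrow> chi n = psi n" by blast
  have "psi \<in> primitive_chars (conductor q chi)"
    unfolding primitive_chars_def
  proof (intro CollectI conjI allI impI)
    fix d phi
    assume d: "d dvd conductor q chi" "dirichlet_char d phi" "\<forall>n. coprime n (conductor q chi) \<longrightarrow> psi n = phi n"
    have "chi n = phi n" if "coprime n q" for n
      using d(3) psi(3)[OF that] that psi(1) by (metis coprime_divisors dvd_refl)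
    then have "conductor q chi \<le> d"
      using d psi(1) by (intro conductor_least) (auto intro: dvd_trans)
    then show "d = conductor q chi"
      using d(1) dchar_pos[OF psi(2)] by (simp add: dvd_imp_le le_antisym)
  qed (rule psi(2))
  with psi that show ?thesis by blast
qed

end

text \<open>Coprimality to r is already enforced by the zeros of \<open>psi\<close>. The remaining
  condition involves only the cofactor q div r and can be moved into the coefficients.\<close>

lemma restrict_primitive_char:
  assumes "psi \<in> primitive_chars r" "r dvd q"
  shows "(if coprime n q then psi n else 0) = (if coprime n (q div r) then psi n else 0)"
proof (cases "coprime n r")
  case True
  have "coprime n q \<longleftrightarrow> coprime n (r * (q div r))" using assms(2) by simp
  with True show ?thesis by simp
next
  case False
  then have "psi n = 0"
    using assms(1) dchar_eq_0_iff by (auto simp: primitive_chars_def)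
  then show ?thesis by simp
qed

section \<open>Reduction to characters of large conductor\<close>

lemma S_sum_eq:
  assumes "q > 0" "coprime a q"
  shows "S_sum \<gamma> \<delta> N1 N2 a q = (1 / of_nat (totient q)) *
     (\<Sum>n1\<in>{1..N1}. \<Sum>n2\<in>{1..N2}. \<gamma> n1 * \<delta> n2 *
       (\<Sum>chi \<in> dirichlet_chars q. chi n1 * cnj (chi (a * n2))))"
proof -
  have t: "of_nat (totient q) \<noteq> (0 :: complex)" using assms by simp
  have "(if [n1 = a * n2] (mod q) \<and> coprime (n1 * n2) q then \<gamma> n1 * \<delta> n2 else 0)
      = 1 / of_nat (totient q) * (\<gamma> n1 * \<delta> n2 * (\<Sum>chi \<in> dirichlet_chars q. chi n1 * cnj (chi (a * n2))))"
    for n1 n2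
  proof (cases "coprime n2 q")
    case True
    then have an: "coprime (a * n2) q" using assms by simp
    moreover have "[n1 = a * n2] (mod q) \<Longrightarrow> coprime n1 q"
      using an cong_imp_coprime cong_sym by blast
    ultimately show ?thesis
      using True t by (subst dchar_orthogonal_dual[OF assms(1) an]) auto
  next
    case False
    then have "(\<Sum>chi \<in> dirichlet_chars q. chi n1 * cnj (chi (a * n2))) = 0"
      by (intro sum.neutral) (auto simp: dirichlet_chars_def dchar_eq_0_iff)
    with False show ?thesis by simp
  qed
  then show ?thesis
    unfolding S_sum_def sum_distrib_left by (intro sum.cong refl)
qed

lemma E_sum_eq:
  assumes "q > 0" "coprime a q"
  shows "E_sum \<gamma> \<delta> N1 N2 Q0 a q =
    (\<Sum>chi | dirichlet_char q chi \<and> real (conductor q chi) > Q0.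
      (\<Sum>n1=1..N1. \<gamma> n1 * chi n1) * (\<Sum>n2=1..N2. \<delta> n2 * cnj (chi n2)) / of_nat (totient q) * cnj (chi a))"
proof -
  let ?L = "{chi. dirichlet_char q chi \<and> real (conductor q chi) \<le> Q0}"
  let ?B = "{chi. dirichlet_char q chi \<and> real (conductor q chi) > Q0}"
  have un: "dirichlet_chars q = ?L \<union> ?B" "?L \<inter> ?B = {}"
    by (auto simp: dirichlet_chars_def)
  then have fin: "finite ?L" "finite ?B"
    using finite_dirichlet_chars[of q] by (metis finite_Un)+
  have split: "(\<Sum>chi \<in> dirichlet_chars q. f chi) - (\<Sum>chi \<in> ?L. f chi) = (\<Sum>chi\<in>?B. f chi)"
    for f :: "(nat \<Rightarrow> complex) \<Rightarrow> complex"
    unfolding un(1) using sum.union_disjoint[OF fin un(2), of f] by simp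
  have "E_sum \<gamma> \<delta> N1 N2 Q0 a q = (1 / of_nat (totient q)) *
     (\<Sum>n1\<in>{1..N1}. \<Sum>n2\<in>{1..N2}. \<gamma> n1 * \<delta> n2 * (\<Sum>chi \<in> ?B. chi n1 * cnj (chi (a * n2))))"
    unfolding E_sum_def S_sum_eq[OF assms] M_sum_def right_diff_distrib[symmetric] sum_subtractf[symmetric] split ..
  also have "\<dots> = (\<Sum>n1\<in>{1..N1}. \<Sum>n2\<in>{1..N2}. \<Sum>chi\<in>?B.
      1 / of_nat (totient q) * (\<gamma> n1 * \<delta> n2 * (chi n1 * cnj (chi (a * n2)))))"
    by (simp only: sum_distrib_left)
  also have "\<dots> = (\<Sum>chi\<in>?B. \<Sum>n1\<in>{1..N1}. \<Sum>n2\<in>{1..N2}.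
      1 / of_nat (totient q) * (\<gamma> n1 * \<delta> n2 * (chi n1 * cnj (chi (a * n2)))))"
    by (rule trans[OF sum.cong[OF refl sum.swap] sum.swap])
  also have "\<dots> = (\<Sum>chi\<in>?B. (\<Sum>n1=1..N1. \<gamma> n1 * chi n1) * (\<Sum>n2=1..N2. \<delta> n2 * cnj (chi n2))
      / of_nat (totient q) * cnj (chi a))"
    unfolding sum_product unfolding sum_distrib_right sum_divide_distrib
    by (intro sum.cong refl) (auto simp: dchar_mult)
  finally show ?thesis .
qed

text \<open>The values E(a, q) are a Fourier expansion in a over the characters of large conductor,
  so orthogonality gives phi(q) times the squares of coefficients that carry a factor 1 /
  phi(q).\<close>

lemma sum_norm_E_sum:
  assumes "q > 0"
  shows "(\<Sum>a\<in>units_mod q. (cmod (E_sum \<gamma> \<delta> N1 N2 Q0 a q))\<^sup>2) =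
    1 / real (totient q) * (\<Sum>chi | dirichlet_char q chi \<and> real (conductor q chi) > Q0.
      (cmod (\<Sum>n=1..N1 * N2. conv_coeff \<gamma> \<delta> N1 N2 n * chi n))\<^sup>2)"
proof -
  let ?B = "{chi. dirichlet_char q chi \<and> real (conductor q chi) > Q0}"
  let ?G = "\<lambda>chi. (\<Sum>n1=1..N1. \<gamma> n1 * chi n1) * (\<Sum>n2=1..N2. \<delta> n2 * cnj (chi n2))"
  have fin: "finite ?B"
    by (rule finite_subset[OF _ finite_dirichlet_chars[of q]]) (auto simp: dirichlet_chars_def)
  have G: "cmod (?G chi) = cmod (\<Sum>n=1..N1 * N2. conv_coeff \<gamma> \<delta> N1 N2 n * chi n)"
    if "chi \<in> ?B" for chi
  proof -
    have "(\<Sum>n=1..N1 * N2. conv_coeff \<gamma> \<delta> N1 N2 n * chi n)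
        = (\<Sum>n1=1..N1. \<Sum>n2=1..N2. \<gamma> n1 * chi n1 * cnj (\<delta> n2 * cnj (chi n2)))"
      using that unfolding sum_conv_coeff by (intro sum.cong refl) (auto simp: dchar_mult)
    also have "\<dots> = (\<Sum>n1=1..N1. \<gamma> n1 * chi n1) * cnj (\<Sum>n2=1..N2. \<delta> n2 * cnj (chi n2))"
      unfolding cnj_sum sum_product ..
    finally show ?thesis by (simp only: norm_mult complex_mod_cnj)
  qed
  have "(\<Sum>a\<in>units_mod q. (cmod (E_sum \<gamma> \<delta> N1 N2 Q0 a q))\<^sup>2)
      = (\<Sum>a\<in>units_mod q. (cmod (\<Sum>chi\<in>?B. ?G chi / of_nat (totient q) * cnj (chi a)))\<^sup>2)"
    using E_sum_eq[OF assms] by (intro sum.cong) (auto simp: units_mod_def)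
  also have "\<dots> = real (totient q) * (\<Sum>chi\<in>?B. (cmod (?G chi / of_nat (totient q)))\<^sup>2)"
  proof (rule parseval_orthogonal[OF fin])
    fix chi psi assume *: "chi \<in> ?B" "psi \<in> ?B"
    have "(\<Sum>a\<in>units_mod q. cnj (chi a) * cnj (cnj (psi a))) = (\<Sum>a\<in>units_mod q. psi a * cnj (chi a))"
      by (simp add: mult.commute)
    also have "\<dots> = (if chi = psi then of_real (real (totient q)) else 0)"
      using * by (subst dchar_orthogonal) auto
    finally show "(\<Sum>a\<in>units_mod q. cnj (chi a) * cnj (cnj (psi a))) = (if chi = psi then of_real (real (totient q)) else 0)" .
  qed
  also have "\<dots> = 1 / real (totient q) * (\<Sum>chi\<in>?B. (cmod (?G chi))\<^sup>2)"
    unfolding sum_distrib_left using assms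
    by (intro sum.cong refl) (simp add: norm_divide power_divide power2_eq_square)
  also have "(\<Sum>chi\<in>?B. (cmod (?G chi))\<^sup>2)
      = (\<Sum>chi\<in>?B. (cmod (\<Sum>n=1..N1 * N2. conv_coeff \<gamma> \<delta> N1 N2 n * chi n))\<^sup>2)"
    by (intro sum.cong refl) (simp only: G)
  finally show ?thesis .
qed

section \<open>Summation over conductors and cofactors\<close>

text \<open>Here s is the cofactor of the conductor r. With the coprimality condition in the
  coefficients, the large sieve applies for each fixed s.\<close>

definition primitive_mass :: "(nat \<Rightarrow> complex) \<Rightarrow> nat \<Rightarrow> nat \<Rightarrow> nat \<Rightarrow> real" where
  "primitive_mass c N s r =
    (\<Sum>psi\<in>primitive_chars r. (cmod (\<Sum>n=1..N. (if coprime n s then c n else 0) * psi n))\<^sup>2)"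

lemma primitive_mass_nonneg: "primitive_mass c N s r \<ge> 0"
  by (simp add: primitive_mass_def sum_nonneg)

lemma large_conductor_sum_le:
  assumes "q > 0"
  shows "(\<Sum>chi | dirichlet_char q chi \<and> real (conductor q chi) > Q0. (cmod (\<Sum>n=1..N. c n * chi n))\<^sup>2)
    \<le> (\<Sum>r | r dvd q \<and> real r > Q0. primitive_mass c N (q div r) r)"
proof -
  let ?R = "{r. r dvd q \<and> real r > Q0}"
  let ?B = "{chi. dirichlet_char q chi \<and> real (conductor q chi) > Q0}"
  have fin: "finite ?B"
    by (rule finite_subset[OF _ finite_dirichlet_chars[of q]]) (auto simp: dirichlet_chars_def)
  have finR: "finite ?R" using assms by (auto intro: finite_subset[of _ "{r. r dvd q}"])
  have finP: "finite (primitive_chars r)" for r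
    by (rule finite_subset[OF primitive_chars_subset]) simp
  have "(\<Sum>chi\<in>?B. (cmod (\<Sum>n=1..N. c n * chi n))\<^sup>2)
     \<le> (\<Sum>(r, psi)\<in>Sigma ?R primitive_chars.
          (cmod (\<Sum>n=1..N. (if coprime n (q div r) then c n else 0) * psi n))\<^sup>2)"
  \<comment> \<open>The pair of conductor and inducing character determines chi by cutting off
    outside the units modulo q; positivity absorbs all other pairs.\<close>
  proof (rule sum_le_included[where i = "\<lambda>(r, psi) n. if coprime n q then psi n else 0"])
    show "\<forall>chi\<in>?B. \<exists>y\<in>Sigma ?R primitive_chars. (\<lambda>(r, psi) n. if coprime n q then psi n else 0) y = chi \<and>
       (cmod (\<Sum>n=1..N. c n * chi n))\<^sup>2 \<le> (case y of (r, psi) \<Rightarrow>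
          (cmod (\<Sum>n=1..N. (if coprime n (q div r) then c n else 0) * psi n))\<^sup>2)"
    proof
      fix chi assume chi: "chi \<in> ?B"
      then have dchar: "dirichlet_char q chi" by simp
      obtain psi where psi: "conductor q chi dvd q" "psi \<in> primitive_chars (conductor q chi)"
        "\<And>n. coprime n q \<Longrightarrow> chi n = psi n"
        using primitive_inducing[OF dchar] by blast
      have eq: "(if coprime n q then psi n else 0) = chi n" for n
        using psi(3) dchar_eq_0_iff[OF dchar] by simp
      have "c n * chi n = (if coprime n (q div conductor q chi) then c n else 0) * psi n" for n
        using restrict_primitive_char[OF psi(2,1), of n] eq[of n] by (simp split: if_splits)
      then show "\<exists>y\<in>Sigma ?R primitive_chars. (\<lambda>(r, psi) n. if coprime n q then psi n else 0) y = chi \<and>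
         (cmod (\<Sum>n=1..N. c n * chi n))\<^sup>2 \<le> (case y of (r, psi) \<Rightarrow>
            (cmod (\<Sum>n=1..N. (if coprime n (q div r) then c n else 0) * psi n))\<^sup>2)"
        using chi psi(1,2) eq by (intro bexI[of _ "(conductor q chi, psi)"]) auto
    qed
  qed (use fin finR finP in auto)
  also have "\<dots> = (\<Sum>r\<in>?R. primitive_mass c N (q div r) r)"
    unfolding primitive_mass_def using finR finP by (subst sum.Sigma) auto
  finally show ?thesis .
qed

text \<open>Follows from phi(m) * phi(n) * gcd(m, n) = phi(m * n) * phi(gcd(m, n)) and phi(g) \<le>
  g.\<close>

lemma totient_mult_ge: "totient m * totient n \<le> totient (m * n)"
proof (cases "m = 0 \<or> n = 0")
  case False
  then have g: "gcd m n > 0" by simp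
  have "totient m * totient n * gcd m n = totient (m * n) * totient (gcd m n)"
    by (simp add: totient_gcd)
  also have "\<dots> \<le> totient (m * n) * gcd m n"
    by (intro mult_left_mono totient_le) auto
  finally show ?thesis using g by (subst (asm) mult_le_cancel2) blast
qed auto

text \<open>The large sieve bounds the sums weighted by r / phi(r); partial summation removes the
  factor r. The start \<open>m\<close> is the least integer exceeding \<open>Q0\<close>, whence 1 /
  m \<le> 1 / Q0.\<close>

lemma sum_primitive_mass_le:
  fixes c :: "nat \<Rightarrow> complex"
  assumes "Q0 \<ge> 1"
  defines "m \<equiv> nat \<lfloor>Q0\<rfloor> + 1"
  shows "(\<Sum>r=m..Q. primitive_mass c N s r / real (totient r))
    \<le> 24 * (real Q + real N / Q0) * (\<Sum>n=1..N. (cmod (c n))\<^sup>2)"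
proof (cases "m \<le> Q")
  case True
  define X where "X = (\<Sum>n=1..N. (cmod (c n))\<^sup>2)"
  define t where "t r = real r / real (totient r) * primitive_mass c N s r" for r
  have X: "X \<ge> 0" unfolding X_def by (intro sum_nonneg) auto
  have t: "t r \<ge> 0" for r by (simp add: t_def primitive_mass_nonneg)
  have m: "m > 0" "Q0 \<le> real m" unfolding m_def using assms(1) by linarith+
  have partial: "(\<Sum>r=m..R. t r) \<le> 4 * X * real R ^ 2 + 24 * real N * X" for R
  proof -
    have "(\<Sum>r=m..R. t r) \<le> (\<Sum>r=1..R. t r)"
      using m t by (intro sum_mono2) auto
    also have "\<dots> \<le> 4 * (real R ^ 2 + 6 * real N) * (\<Sum>n=1..N. (cmod (if coprime n s then c n else 0))\<^sup>2)"
      unfolding t_def primitive_mass_def by (rule multiplicative_large_sieve)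
    also have "\<dots> \<le> 4 * (real R ^ 2 + 6 * real N) * X"
      unfolding X_def by (intro mult_left_mono sum_mono) auto
    finally show ?thesis by (simp add: algebra_simps)
  qed
  have Q: "real Q > 0" "1 / real m \<ge> 0" using True m by auto
  have "(\<Sum>r=m..Q. primitive_mass c N s r / real (totient r)) = (\<Sum>r=m..Q. t r / real r)"
    using m by (intro sum.cong) (auto simp: t_def)
  also have "\<dots> \<le> (\<Sum>r=m..Q. t r) / real Q + 4 * X * (real Q - real m) + 24 * real N * X * (1 / real m - 1 / real Q)"
    using m True X by (intro sum_reciprocal_weights_le partial) auto
  also have "\<dots> \<le> (4 * X * real Q ^ 2 + 24 * real N * X) / real Q + 4 * X * real Q + 24 * real N * X * (1 / real m - 1 / real Q)"
    using X by (intro add_mono divide_right_mono mult_left_mono partial) auto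
  \<comment> \<open>The two terms 24 * N * X / Q, one from the boundary and one from the telescoped
    sum, cancel.\<close>
  also have "\<dots> = 8 * X * real Q + 24 * real N * X / real m"
    using Q by (simp add: field_simps power2_eq_square)
  also have "\<dots> \<le> 24 * X * real Q + 24 * real N * X / Q0"
    using X Q m assms(1) by (intro add_mono mult_right_mono divide_left_mono) auto
  finally show ?thesis by (simp add: X_def algebra_simps)
next
  case False
  have "0 \<le> 24 * (real Q + real N / Q0) * (\<Sum>n=1..N. (cmod (c n))\<^sup>2)"
    using assms(1) by (intro mult_nonneg_nonneg sum_nonneg) auto
  with False show ?thesis by simp
qed

text \<open>After q = s * r, positivity lets s and r range independently up to Q.\<close>

lemma sum_moduli_le:
  fixes c :: "nat \<Rightarrow> complex"
  assumes "Q0 \<ge> 1"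
  shows "(\<Sum>q=1..Q. 1 / real (totient q) * (\<Sum>r | r dvd q \<and> real r > Q0. primitive_mass c N (q div r) r))
    \<le> (\<Sum>s=1..Q. 1 / real (totient s) * (\<Sum>r=nat \<lfloor>Q0\<rfloor> + 1..Q. primitive_mass c N s r / real (totient r)))"
proof -
  let ?m = "nat \<lfloor>Q0\<rfloor> + 1"
  let ?A = "SIGMA q:{1..Q}. {r. r dvd q \<and> real r > Q0}"
  have finA: "finite {r. r dvd q \<and> real r > Q0}" if "q \<in> {1..Q}" for q
    using that by (auto intro: finite_subset[of _ "{r. r dvd q}"])
  have "(\<Sum>q=1..Q. 1 / real (totient q) * (\<Sum>r | r dvd q \<and> real r > Q0. primitive_mass c N (q div r) r))
      = (\<Sum>(q, r)\<in>?A. 1 / real (totient q) * primitive_mass c N (q div r) r)"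
    unfolding sum_distrib_left using finA by (intro sum.Sigma) auto
  also have "\<dots> \<le> (\<Sum>(s, r)\<in>{1..Q} \<times> {?m..Q}. 1 / real (totient s) * (primitive_mass c N s r / real (totient r)))"
  proof (rule sum_le_included[where i = "\<lambda>(s, r). (s * r, r)"])
    show "\<forall>x\<in>?A. \<exists>y\<in>{1..Q} \<times> {?m..Q}. (\<lambda>(s, r). (s * r, r)) y = x \<and>
      (case x of (q, r) \<Rightarrow> 1 / real (totient q) * primitive_mass c N (q div r) r)
      \<le> (case y of (s, r) \<Rightarrow> 1 / real (totient s) * (primitive_mass c N s r / real (totient r)))"
    proof clarify
      fix q r assume qr: "q \<in> {1..Q}" "r dvd q" "Q0 < real r"
      then obtain s where s: "q = s * r" by (metis dvdE mult.commute)
      have pos: "s > 0" "r > 0" using qr s by (auto intro: Nat.gr0I)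
      have "s * r \<le> Q" using qr s by simp
      moreover have "s \<le> s * r" "r \<le> s * r" using pos by auto
      ultimately have "s \<le> Q" "r \<le> Q" by (blast intro: order.trans)+
      then have "s \<in> {1..Q}" "r \<le> Q" using pos by auto
      moreover have "?m \<le> r" using qr(3) assms by linarith
      moreover have "1 / real (totient q) * primitive_mass c N (q div r) r
          \<le> 1 / real (totient s) * (primitive_mass c N s r / real (totient r))"
      proof -
        have "real (totient s) * real (totient r) \<le> real (totient q)"
          unfolding s using totient_mult_ge[of s r] by (metis of_nat_le_iff of_nat_mult)
        then have "1 / real (totient q) \<le> 1 / (real (totient s) * real (totient r))"
          using pos s by (intro divide_left_mono) auto
        from mult_right_mono[OF this primitive_mass_nonneg[of c N s r]] show ?thesis
          using pos s by simp
      qed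
      ultimately show "\<exists>y\<in>{1..Q} \<times> {?m..Q}. (\<lambda>(s, r). (s * r, r)) y = (q, r) \<and>
        1 / real (totient q) * primitive_mass c N (q div r) r
        \<le> (case y of (s, r) \<Rightarrow> 1 / real (totient s) * (primitive_mass c N s r / real (totient r)))"
        using s by (intro bexI[of _ "(s, r)"]) auto
    qed
  qed (use finA in \<open>auto simp: primitive_mass_nonneg\<close>)
  also have "\<dots> = (\<Sum>s=1..Q. 1 / real (totient s) * (\<Sum>r=?m..Q. primitive_mass c N s r / real (totient r)))"
    unfolding sum.cartesian_product[symmetric] sum_distrib_left ..
  finally show ?thesis .
qed

lemma E_sum_mean_square_le:
  assumes supp: "\<forall>n. (n = 0 \<or> n > N1) \<longrightarrow> \<gamma> n = 0" "\<forall>n. (n = 0 \<or> n > N2) \<longrightarrow> \<delta> n = 0"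
    and Q0: "Q0 \<ge> 1"
  shows "(\<Sum>q\<in>{1..Q}. \<Sum>a\<in>{a. a < q \<and> coprime a q}. (cmod (E_sum \<gamma> \<delta> N1 N2 Q0 a q))\<^sup>2)
    \<le> 288 * (real Q + real N1 * real N2 / Q0) * ln (real Q) * tau_norm2 \<gamma> * tau_norm2 \<delta>"
proof -
  define c where "c = conv_coeff \<gamma> \<delta> N1 N2"
  define N where "N = N1 * N2"
  define X where "X = (\<Sum>n=1..N. (cmod (c n))\<^sup>2)"
  define Y where "Y = tau_norm2 \<gamma> * tau_norm2 \<delta>"
  define M where "M = 24 * (real Q + real N / Q0) * X"
  have X: "0 \<le> X" "X \<le> Y"
    unfolding X_def Y_def N_def c_def using conv_coeff_norm2_le[OF supp] by (auto intro: sum_nonneg)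
  have M: "0 \<le> M"
    unfolding M_def using Q0 X by (intro mult_nonneg_nonneg) auto
  have "(\<Sum>q\<in>{1..Q}. \<Sum>a\<in>{a. a < q \<and> coprime a q}. (cmod (E_sum \<gamma> \<delta> N1 N2 Q0 a q))\<^sup>2)
      = (\<Sum>q=1..Q. 1 / real (totient q) * (\<Sum>chi | dirichlet_char q chi \<and> real (conductor q chi) > Q0.
          (cmod (\<Sum>n=1..N. c n * chi n))\<^sup>2))"
    unfolding units_mod_def[symmetric] c_def N_def by (intro sum.cong refl sum_norm_E_sum) auto
  also have "\<dots> \<le> (\<Sum>q=1..Q. 1 / real (totient q) * (\<Sum>r | r dvd q \<and> real r > Q0. primitive_mass c N (q div r) r))"
    by (intro sum_mono mult_left_mono large_conductor_sum_le) auto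
  also have "\<dots> \<le> (\<Sum>s=1..Q. 1 / real (totient s) * (\<Sum>r=nat \<lfloor>Q0\<rfloor> + 1..Q. primitive_mass c N s r / real (totient r)))"
    using Q0 by (rule sum_moduli_le)
  also have "\<dots> \<le> 288 * (real Q + real N / Q0) * ln (real Q) * Y"
  proof (cases "Q \<ge> 2")
    case True
    have "(\<Sum>s=1..Q. 1 / real (totient s) * (\<Sum>r=nat \<lfloor>Q0\<rfloor> + 1..Q. primitive_mass c N s r / real (totient r)))
        \<le> (\<Sum>s=1..Q. 1 / real (totient s) * M)"
      unfolding M_def X_def using Q0 by (intro sum_mono mult_left_mono sum_primitive_mass_le) auto
    also have "\<dots> = (\<Sum>s=1..Q. 1 / real (totient s)) * M"
      by (rule sum_distrib_right[symmetric])
    also have "\<dots> \<le> 12 * ln (real Q) * M"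
      using M by (intro mult_right_mono sum_inverse_totient_le True)
    \<comment> \<open>The constant 288 is 12 from the sum of reciprocal totients times 24 from the
      large sieve.\<close>
    also have "\<dots> = 288 * (real Q + real N / Q0) * ln (real Q) * X"
      by (simp add: M_def)
    also have "\<dots> \<le> 288 * (real Q + real N / Q0) * ln (real Q) * Y"
      using X Q0 True by (intro mult_left_mono mult_nonneg_nonneg add_nonneg_nonneg) auto
    finally show ?thesis .
  next
    \<comment> \<open>For Q \<le> 1 the logarithm is 0, but conductors exceed \<open>Q0\<close>
      \<ge> 1, so the range of r is empty and both sides vanish.\<close>
    case False
    then have "Q = 0 \<or> Q = 1" by auto
    moreover have "nat \<lfloor>Q0\<rfloor> + 1 > 1" using Q0 by linarith
    ultimately show ?thesis by auto
  qed
  finally show ?thesis by (simp add: N_def Y_def mult.assoc)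
qed

theorem theorem2:
  shows "\<exists>C>0. \<forall>(\<gamma>::nat \<Rightarrow> complex) (\<delta>::nat \<Rightarrow> complex) (N1::nat) (N2::nat) (Q0::real) (Q::nat).
     (\<forall>n. (n = 0 \<or> n > N1) \<longrightarrow> \<gamma> n = 0) \<longrightarrow>
     (\<forall>n. (n = 0 \<or> n > N2) \<longrightarrow> \<delta> n = 0) \<longrightarrow>
     Q0 \<ge> 1 \<longrightarrow>
     (\<Sum>q\<in>{1..Q}. \<Sum>a\<in>{a. a < q \<and> coprime a q}. (cmod (E_sum \<gamma> \<delta> N1 N2 Q0 a q))^2)
       \<le> C * (real Q + real N1 * real N2 / Q0) * ln (real Q) * tau_norm2 \<gamma> * tau_norm2 \<delta>"
  by (rule exI[of _ 288]) (use E_sum_mean_square_le in simp)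

end
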